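(* Let $G$ be a finite abelian group and let $n\ge 2$ be an integer. Both homomorphisms $\mu:\mathcal{B}_n(G)\to\mathcal{M}_n(G)$ and $\mu^-:\mathcal{B}_n^-(G)\to\mathcal{M}_n^-(G)$ (the latter being defined only for nontrivial $G$) are isomorphisms after tensoring with $\mathbb{Q}$.
   Context: Let $k$ be an algebraically closed field of characteristic zero, $G$ a finite abelian group, and $A=\mathrm{Hom}(G,k^\times)$ its character group, written additively. Let $\mathcal{S}_n(G)$ be the free abelian group generated by symbols $[a_1,\ldots,a_n]$, where $a_1,\ldots,a_n\in A$ generate $A$, and symbols are taken up to permutation of the entries: $[a_1,\ldots,a_n]=[a_{\sigma(1)},\ldots,a_{\sigma(n)}]$ for all $\sigma\in\mathfrak{S}_n$. For $n\ge 2$, $\mathcal{B}_n(G)$ is the quotient of $\mathcal{S}_n(G)$ by the relations, for all symbols $[a_1,a_2,b_1,\ldots,b_{n-2}]$: $$[a_1,a_2,b_1,\ldots,b_{n-2}]=[a_1,a_2-a_1,b_1,\ldots,b_{n-2}]+[a_1-a_2,a_2,b_1,\ldots,b_{n-2}]\quad\text{if } a_1\ne a_2,$$ $$[a_1,a_2,b_1,\ldots,b_{n-2}]=[0,a_1,b_1,\ldots,b_{n-2}]\quad\text{if } a_1=a_2.$$ $\mathcal{M}_n(G)$ is the quotient of $\mathcal{S}_n(G)$ by the relations, for all symbols $[a_1,a_2,b_1,\ldots,b_{n-2}]$ (including the case $a_1=a_2$): $$[a_1,a_2,b_1,\ldots,b_{n-2}]=[a_1,a_2-a_1,b_1,\ldots,b_{n-2}]+[a_1-a_2,a_2,b_1,\ldots,b_{n-2}].$$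 The image of a generator $[a_1,\ldots,a_n]$ in $\mathcal{M}_n(G)$ is written $\langle a_1,\ldots,a_n\rangle$. The homomorphism $\mu:\mathcal{B}_n(G)\to\mathcal{M}_n(G)$ is defined on symbols by $\mu([a_1,\ldots,a_n])=\langle a_1,\ldots,a_n\rangle$ if all $a_i\ne 0$; $\mu([a_1,\ldots,a_n])=2\langle a_1,\ldots,a_n\rangle$ if exactly one $a_i$ is $0$; and $\mu([a_1,\ldots,a_n])=0$ otherwise. (It is known that this respects the relations.) For nontrivial $G$, $\mathcal{B}_n^-(G)$ (respectively $\mathcal{M}_n^-(G)$) is the quotient of $\mathcal{B}_n(G)$ (respectively $\mathcal{M}_n(G)$) by the additional relations $[-a_1,a_2,\ldots,a_n]=-[a_1,a_2,\ldots,a_n]$ (respectively $\langle -a_1,a_2,\ldots,a_n\rangle=-\langle a_1,a_2,\ldots,a_n\rangle$) for all symbols. The homomorphism $\mu^-:\mathcal{B}_n^-(G)\to\mathcal{M}_n^-(G)$ is given on symbols by the same formula as $\mu$.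
   Formalization: The group G is assumed nontrivial for μ as well as for μ⁻, because for trivial G and n ≥ 2 one has B_n(G) = ℤ and M_n(G) = 0, so μ is not an isomorphism after tensoring with ℚ. *)

theory Defs
  imports "HOL-Algebra.Algebra"
begin

section \<open>Abelian groups given by generators and relations\<close>

definition presented_group :: "'s set \<Rightarrow> ('s \<Rightarrow>\<^sub>0 int) set \<Rightarrow> ('s \<Rightarrow>\<^sub>0 int) set monoid" where
  "presented_group S R = free_Abelian_group S Mod generate (free_Abelian_group S) R"

definition presented_class :: "'s set \<Rightarrow> ('s \<Rightarrow>\<^sub>0 int) set \<Rightarrow> ('s \<Rightarrow>\<^sub>0 int) \<Rightarrow> ('s \<Rightarrow>\<^sub>0 int) set" where
  "presented_class S R c = generate (free_Abelian_group S) R #>\<^bsub>free_Abelian_group S\<^esub> c"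

text \<open>The map of quotients induced by the linear extension of \<open>h\<close>, with target
  \<^term>\<open>presented_group S' R'\<close>. As for \<open>FactGroup_hom\<close> in the library, it is read off from the
  image of a coset; lemmas \<open>presented_map_class\<close> and \<open>presented_map_hom\<close> below show that this
  is the intended homomorphism whenever the relations are respected.\<close>

definition presented_map ::
    "'t set \<Rightarrow> ('t \<Rightarrow>\<^sub>0 int) set \<Rightarrow> ('s \<Rightarrow> ('t \<Rightarrow>\<^sub>0 int)) \<Rightarrow> ('s \<Rightarrow>\<^sub>0 int) set \<Rightarrow> ('t \<Rightarrow>\<^sub>0 int) set" where
  "presented_map S' R' h = (\<lambda>U. the_elem ((\<lambda>c. presented_class S' R' (frag_extend h c)) ` U))"

section \<open>Tensor product with the rationals\<close>

definition tensor_relators ::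
    "('a, 'm) monoid_scheme \<Rightarrow> ('b, 'n) monoid_scheme \<Rightarrow> ('a \<times> 'b \<Rightarrow>\<^sub>0 int) set" where
  "tensor_relators G H =
     {frag_of (x \<otimes>\<^bsub>G\<^esub> x', y) - frag_of (x, y) - frag_of (x', y) | x x' y.
        x \<in> carrier G \<and> x' \<in> carrier G \<and> y \<in> carrier H} \<union>
     {frag_of (x, y \<otimes>\<^bsub>H\<^esub> y') - frag_of (x, y) - frag_of (x, y') | x y y'.
        x \<in> carrier G \<and> y \<in> carrier H \<and> y' \<in> carrier H}"

definition tensor_group ::
    "('a, 'm) monoid_scheme \<Rightarrow> ('b, 'n) monoid_scheme \<Rightarrow> ('a \<times> 'b \<Rightarrow>\<^sub>0 int) set monoid" where
  "tensor_group G H = presented_group (carrier G \<times> carrier H) (tensor_relators G H)"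

definition rat_group :: "rat monoid" where
  "rat_group = \<lparr>carrier = UNIV, monoid.mult = (+), one = 0\<rparr>"

abbreviation tensor_rat :: "('a, 'm) monoid_scheme \<Rightarrow> ('a \<times> rat \<Rightarrow>\<^sub>0 int) set monoid" where
  "tensor_rat G \<equiv> tensor_group G rat_group"

text \<open>The homomorphism \<open>f \<otimes> id\<close> with target \<^term>\<open>tensor_rat G'\<close>.\<close>

definition tensor_rat_map ::
    "('b, 'n) monoid_scheme \<Rightarrow> ('a \<Rightarrow> 'b) \<Rightarrow> ('a \<times> rat \<Rightarrow>\<^sub>0 int) set \<Rightarrow> ('b \<times> rat \<Rightarrow>\<^sub>0 int) set" where
  "tensor_rat_map G' f =
     presented_map (carrier G' \<times> carrier rat_group) (tensor_relators G' rat_group)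
       (\<lambda>(x, q). frag_of (f x, q))"

section \<open>Characters and symbols\<close>

text \<open>Characters are made extensional, so that equality of functions is equality of characters.
  The group is in multiplicative notation as in \<open>HOL-Algebra\<close>: the trivial character, written 0
  in the additive notation, is \<open>\<one>\<close>, and \<open>a - b\<close> is \<^term>\<open>a \<otimes>\<^bsub>A\<^esub> inv\<^bsub>A\<^esub> b\<close>.\<close>

definition character_group ::
    "('g, 'm) monoid_scheme \<Rightarrow> ('k, 'r) ring_scheme \<Rightarrow> ('g \<Rightarrow> 'k) monoid" where
  "character_group G K =
     \<lparr>carrier = hom G (units_of K) \<inter> extensional (carrier G),
      monoid.mult = (\<lambda>\<chi> \<psi>. \<lambda>x\<in>carrier G. \<chi> x \<otimes>\<^bsub>K\<^esub> \<psi> x),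
      one = (\<lambda>x\<in>carrier G. \<one>\<^bsub>K\<^esub>)\<rparr>"

definition symbols :: "nat \<Rightarrow> ('a, 'm) monoid_scheme \<Rightarrow> 'a multiset set" where
  "symbols n A =
     {s. size s = n \<and> set_mset s \<subseteq> carrier A \<and> generate A (set_mset s) = carrier A}"

definition subtract_relator :: "('a, 'm) monoid_scheme \<Rightarrow> 'a \<Rightarrow> 'a \<Rightarrow> 'a multiset \<Rightarrow> ('a multiset \<Rightarrow>\<^sub>0 int)" where
  "subtract_relator A a1 a2 b =
     frag_of ({#a1, a2#} + b)
       - frag_of ({#a1, a2 \<otimes>\<^bsub>A\<^esub> inv\<^bsub>A\<^esub> a1#} + b)
       - frag_of ({#a1 \<otimes>\<^bsub>A\<^esub> inv\<^bsub>A\<^esub> a2, a2#} + b)"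

definition B_relators :: "nat \<Rightarrow> ('a, 'm) monoid_scheme \<Rightarrow> ('a multiset \<Rightarrow>\<^sub>0 int) set" where
  "B_relators n A =
     {subtract_relator A a1 a2 b | a1 a2 b. {#a1, a2#} + b \<in> symbols n A \<and> a1 \<noteq> a2} \<union>
     {frag_of ({#a1, a2#} + b) - frag_of ({#\<one>\<^bsub>A\<^esub>, a1#} + b) | a1 a2 b.
        {#a1, a2#} + b \<in> symbols n A \<and> a1 = a2}"

definition M_relators :: "nat \<Rightarrow> ('a, 'm) monoid_scheme \<Rightarrow> ('a multiset \<Rightarrow>\<^sub>0 int) set" where
  "M_relators n A =
     {subtract_relator A a1 a2 b | a1 a2 b. {#a1, a2#} + b \<in> symbols n A}"

definition minus_relators :: "nat \<Rightarrow> ('a, 'm) monoid_scheme \<Rightarrow> ('a multiset \<Rightarrow>\<^sub>0 int) set" where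
  "minus_relators n A =
     {frag_of ({#inv\<^bsub>A\<^esub> a#} + b) + frag_of ({#a#} + b) | a b. {#a#} + b \<in> symbols n A}"

section \<open>The groups and the comparison homomorphisms\<close>

definition B_group ::
    "nat \<Rightarrow> ('g, 'm) monoid_scheme \<Rightarrow> ('k, 'r) ring_scheme \<Rightarrow> (('g \<Rightarrow> 'k) multiset \<Rightarrow>\<^sub>0 int) set monoid" where
  "B_group n G K =
     presented_group (symbols n (character_group G K)) (B_relators n (character_group G K))"

definition M_group ::
    "nat \<Rightarrow> ('g, 'm) monoid_scheme \<Rightarrow> ('k, 'r) ring_scheme \<Rightarrow> (('g \<Rightarrow> 'k) multiset \<Rightarrow>\<^sub>0 int) set monoid" where
  "M_group n G K =
     presented_group (symbols n (character_group G K)) (M_relators n (character_group G K))"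

text \<open>The quotients by the additional relations are presented by the union of the two sets of
  relators on the same generators.\<close>

definition B_minus_group ::
    "nat \<Rightarrow> ('g, 'm) monoid_scheme \<Rightarrow> ('k, 'r) ring_scheme \<Rightarrow> (('g \<Rightarrow> 'k) multiset \<Rightarrow>\<^sub>0 int) set monoid" where
  "B_minus_group n G K =
     presented_group (symbols n (character_group G K))
       (B_relators n (character_group G K) \<union> minus_relators n (character_group G K))"

definition M_minus_group ::
    "nat \<Rightarrow> ('g, 'm) monoid_scheme \<Rightarrow> ('k, 'r) ring_scheme \<Rightarrow> (('g \<Rightarrow> 'k) multiset \<Rightarrow>\<^sub>0 int) set monoid" where
  "M_minus_group n G K =
     presented_group (symbols n (character_group G K))
       (M_relators n (character_group G K) \<union> minus_relators n (character_group G K))"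

definition mu_symbol :: "('a, 'm) monoid_scheme \<Rightarrow> 'a multiset \<Rightarrow> ('a multiset \<Rightarrow>\<^sub>0 int)" where
  "mu_symbol A s =
     (if count s \<one>\<^bsub>A\<^esub> = 0 then frag_of s
      else if count s \<one>\<^bsub>A\<^esub> = 1 then frag_cmul 2 (frag_of s)
      else 0)"

text \<open>For trivial \<open>G\<close> and \<open>n \<ge> 2\<close> the only symbol is \<open>[0, \<dots>, 0]\<close>; then \<^term>\<open>B_group n G K\<close> is infinite
  cyclic, since its only relation is \<open>[0, \<dots>, 0] = [0, \<dots>, 0]\<close>, while \<^term>\<open>M_group n G K\<close>
  vanishes, since there \<open>[0, \<dots>, 0] = 2 [0, \<dots>, 0]\<close>. So the map below is not rationally an
  isomorphism for trivial \<open>G\<close>.\<close>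

definition mu ::
    "nat \<Rightarrow> ('g, 'm) monoid_scheme \<Rightarrow> ('k, 'r) ring_scheme \<Rightarrow>
     (('g \<Rightarrow> 'k) multiset \<Rightarrow>\<^sub>0 int) set \<Rightarrow> (('g \<Rightarrow> 'k) multiset \<Rightarrow>\<^sub>0 int) set" where
  "mu n G K =
     presented_map (symbols n (character_group G K)) (M_relators n (character_group G K))
       (mu_symbol (character_group G K))"

definition mu_minus ::
    "nat \<Rightarrow> ('g, 'm) monoid_scheme \<Rightarrow> ('k, 'r) ring_scheme \<Rightarrow>
     (('g \<Rightarrow> 'k) multiset \<Rightarrow>\<^sub>0 int) set \<Rightarrow> (('g \<Rightarrow> 'k) multiset \<Rightarrow>\<^sub>0 int) set" where
  "mu_minus n G K =
     presented_map (symbols n (character_group G K))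
       (M_relators n (character_group G K) \<union> minus_relators n (character_group G K))
       (mu_symbol (character_group G K))"

section \<open>Induced maps are well defined\<close>

abbreviation relator_span :: "'s set \<Rightarrow> ('s \<Rightarrow>\<^sub>0 int) set \<Rightarrow> ('s \<Rightarrow>\<^sub>0 int) set" where
  "relator_span S R \<equiv> generate (free_Abelian_group S) R"

lemma subgroup_span:
  assumes "R \<subseteq> carrier (free_Abelian_group S)"
  shows "subgroup (relator_span S R) (free_Abelian_group S)"
  using assms by (simp add: group.generate_is_subgroup)

lemma normal_span:
  assumes "R \<subseteq> carrier (free_Abelian_group S)"
  shows "relator_span S R \<lhd> free_Abelian_group S"
  using assms by (simp add: abelian_free_Abelian_group comm_group.normal_iff_subgroup subgroup_span)

lemma comm_group_presented_group:
  assumes "R \<subseteq> carrier (free_Abelian_group S)"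
  shows "comm_group (presented_group S R)"
  unfolding presented_group_def
  by (intro comm_group.abelian_FactGroup abelian_free_Abelian_group subgroup_span assms)

lemma span_add:
  assumes "R \<subseteq> carrier (free_Abelian_group S)" "x \<in> relator_span S R" "y \<in> relator_span S R"
  shows "x + y \<in> relator_span S R"
  using subgroup.m_closed[OF subgroup_span[OF assms(1)] assms(2,3)] by simp

lemma span_minus:
  assumes "R \<subseteq> carrier (free_Abelian_group S)" "x \<in> relator_span S R"
  shows "- x \<in> relator_span S R"
  using subgroup.m_inv_closed[OF subgroup_span[OF assms(1)] assms(2)]
    subgroup.mem_carrier[OF subgroup_span[OF assms(1)] assms(2)] by simp

lemma span_zero:
  assumes "R \<subseteq> carrier (free_Abelian_group S)"
  shows "0 \<in> relator_span S R"
  using subgroup.one_closed[OF subgroup_span[OF assms]] by simp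

lemma frag_extend_closed:
  assumes "\<And>s. s \<in> S \<Longrightarrow> h s \<in> carrier (free_Abelian_group S')"
    and "c \<in> carrier (free_Abelian_group S)"
  shows "frag_extend h c \<in> carrier (free_Abelian_group S')"
proof -
  have "Poly_Mapping.keys (frag_extend h c) \<subseteq> (\<Union>x\<in>Poly_Mapping.keys c. Poly_Mapping.keys (h x))"
    by (rule keys_frag_extend)
  also have "\<dots> \<subseteq> S'" using assms by fastforce
  finally show ?thesis by simp
qed

lemma frag_extend_span:
  assumes "R \<subseteq> carrier (free_Abelian_group S)" "R' \<subseteq> carrier (free_Abelian_group S')"
    and rel: "\<And>r. r \<in> R \<Longrightarrow> frag_extend h r \<in> relator_span S' R'"
    and "c \<in> relator_span S R"
  shows "frag_extend h c \<in> relator_span S' R'"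
  using assms(4)
proof (induction rule: generate.induct)
  case one
  then show ?case using span_zero[OF assms(2)] by simp
next
  case (incl r)
  then show ?case by (rule rel)
next
  case (inv r)
  then have "r \<in> carrier (free_Abelian_group S)" using assms(1) by blast
  then show ?case using span_minus[OF assms(2) rel[OF inv]] by (simp add: frag_extend_minus)
next
  case (eng h1 h2)
  then show ?case using span_add[OF assms(2)] by (simp add: frag_extend_add)
qed

lemma presented_map_class:
  assumes "R \<subseteq> carrier (free_Abelian_group S)" "R' \<subseteq> carrier (free_Abelian_group S')"
    and h: "\<And>s. s \<in> S \<Longrightarrow> h s \<in> carrier (free_Abelian_group S')"
    and rel: "\<And>r. r \<in> R \<Longrightarrow> frag_extend h r \<in> relator_span S' R'"
    and c: "c \<in> carrier (free_Abelian_group S)"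
  shows "presented_map S' R' h (presented_class S R c) = presented_class S' R' (frag_extend h c)"
proof -
  have "presented_class S' R' (frag_extend h x) = presented_class S' R' (frag_extend h c)"
    if x: "x \<in> presented_class S R c" for x
  proof -
    from x obtain d where d: "d \<in> relator_span S R" "x = d + c"
      by (auto simp: presented_class_def r_coset_def)
    have "frag_extend h x = frag_extend h d \<otimes>\<^bsub>free_Abelian_group S'\<^esub> frag_extend h c"
      by (simp add: d(2) frag_extend_add)
    moreover have "frag_extend h d \<in> relator_span S' R'"
      using frag_extend_span[OF assms(1,2) rel d(1)] .
    ultimately have "frag_extend h x \<in> presented_class S' R' (frag_extend h c)"
      unfolding presented_class_def r_coset_def by blast
    then show ?thesis
      unfolding presented_class_def
      by (rule group.repr_independence[OF group_free_Abelian_group _ frag_extend_closed[OF h c]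
          subgroup_span[OF assms(2)], symmetric])
  qed
  moreover have "c \<in> presented_class S R c"
    unfolding presented_class_def
    using group.rcos_self[OF group_free_Abelian_group c subgroup_span[OF assms(1)]] .
  ultimately have "(\<lambda>x. presented_class S' R' (frag_extend h x)) ` presented_class S R c
      = {presented_class S' R' (frag_extend h c)}"
    by blast
  then show ?thesis by (simp add: presented_map_def)
qed

lemma carrier_presented_group:
  "carrier (presented_group S R) = presented_class S R ` carrier (free_Abelian_group S)"
  by (auto simp: presented_group_def presented_class_def FactGroup_def RCOSETS_def)

lemma mult_presented_class:
  assumes "R \<subseteq> carrier (free_Abelian_group S)"
    and "c \<in> carrier (free_Abelian_group S)" "d \<in> carrier (free_Abelian_group S)"
  shows "presented_class S R c \<otimes>\<^bsub>presented_group S R\<^esub> presented_class S R d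
           = presented_class S R (c + d)"
  using normal.rcos_sum[OF normal_span[OF assms(1)] assms(2,3)]
  by (simp add: presented_group_def presented_class_def FactGroup_def)

lemma presented_map_hom:
  assumes "R \<subseteq> carrier (free_Abelian_group S)" "R' \<subseteq> carrier (free_Abelian_group S')"
    and h: "\<And>s. s \<in> S \<Longrightarrow> h s \<in> carrier (free_Abelian_group S')"
    and rel: "\<And>r. r \<in> R \<Longrightarrow> frag_extend h r \<in> relator_span S' R'"
  shows "presented_map S' R' h \<in> hom (presented_group S R) (presented_group S' R')"
proof (rule homI)
  note carrier = carrier_presented_group and mult = mult_presented_class
  have cls: "presented_map S' R' h (presented_class S R c) = presented_class S' R' (frag_extend h c)"
    if "c \<in> carrier (free_Abelian_group S)" for c
    using presented_map_class[OF assms(1,2) h rel that] .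
  have closed: "frag_extend h c \<in> carrier (free_Abelian_group S')"
    if "c \<in> carrier (free_Abelian_group S)" for c
    using frag_extend_closed[OF h that] .
  show "presented_map S' R' h U \<in> carrier (presented_group S' R')"
    if U: "U \<in> carrier (presented_group S R)" for U
  proof -
    obtain c where c: "c \<in> carrier (free_Abelian_group S)" "U = presented_class S R c"
      using U by (auto simp: carrier simp del: carrier_free_Abelian_group_iff)
    show ?thesis
      unfolding c(2) cls[OF c(1)] carrier by (rule imageI[OF closed[OF c(1)]])
  qed
  show "presented_map S' R' h (U \<otimes>\<^bsub>presented_group S R\<^esub> V)
      = presented_map S' R' h U \<otimes>\<^bsub>presented_group S' R'\<^esub> presented_map S' R' h V"
    if UV: "U \<in> carrier (presented_group S R)" "V \<in> carrier (presented_group S R)" for U V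
  proof -
    obtain c d where cd: "c \<in> carrier (free_Abelian_group S)" "d \<in> carrier (free_Abelian_group S)"
      "U = presented_class S R c" "V = presented_class S R d"
      using UV by (auto simp: carrier simp del: carrier_free_Abelian_group_iff)
    have sum: "c + d \<in> carrier (free_Abelian_group S)"
      using monoid.m_closed[OF group.is_monoid[OF group_free_Abelian_group] cd(1,2)] by simp
    show ?thesis
      unfolding cd(3,4) mult[OF assms(1) cd(1,2)] cls[OF cd(1)] cls[OF cd(2)] cls[OF sum]
        frag_extend_add
      by (rule mult[OF assms(2) closed[OF cd(1)] closed[OF cd(2)], symmetric])
  qed
qed

lemma keys_frag_of_diff: "Poly_Mapping.keys (frag_of x - frag_of y) \<subseteq> {x, y}"
  using keys_diff[of "frag_of x" "frag_of y"] by auto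

lemma keys_frag_of_diff2: "Poly_Mapping.keys (frag_of x - frag_of y - frag_of z) \<subseteq> {x, y, z}"
  using keys_diff[of "frag_of x - frag_of y" "frag_of z"] keys_frag_of_diff[of x y] by auto

lemma frag_of_diff2_closed:
  assumes "x \<in> S" "y \<in> S" "z \<in> S"
  shows "frag_of x - frag_of y - frag_of z \<in> carrier (free_Abelian_group S)"
  using keys_frag_of_diff2[of x y z] assms by auto

lemma tensor_relators_closed:
  assumes "group G" "group H"
  shows "tensor_relators G H \<subseteq> carrier (free_Abelian_group (carrier G \<times> carrier H))"
proof -
  interpret G: group G by fact
  interpret H: group H by fact
  show ?thesis
    unfolding tensor_relators_def
    by (intro Un_least subsetI; elim CollectE exE conjE; hypsubst)
      (intro frag_of_diff2_closed; simp)+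
qed

lemma group_rat_group: "group rat_group"
proof (rule groupI)
  show "\<exists>y\<in>carrier rat_group. y \<otimes>\<^bsub>rat_group\<^esub> x = \<one>\<^bsub>rat_group\<^esub>" for x
    by (rule bexI[of _ "- x"]) (auto simp: rat_group_def)
qed (auto simp: rat_group_def)

lemma tensor_rat_map_hom:
  assumes "group G" "group G'" "f \<in> hom G G'"
  shows "tensor_rat_map G' f \<in> hom (tensor_rat G) (tensor_rat G')"
  unfolding tensor_rat_map_def tensor_group_def
proof (rule presented_map_hom[OF tensor_relators_closed[OF assms(1) group_rat_group]
      tensor_relators_closed[OF assms(2) group_rat_group]])
  fix s assume "s \<in> carrier G \<times> carrier rat_group"
  then show "(case s of (x, q) \<Rightarrow> frag_of (f x, q))
      \<in> carrier (free_Abelian_group (carrier G' \<times> carrier rat_group))"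
    using assms(3) by (auto simp: hom_def)
next
  fix r assume "r \<in> tensor_relators G rat_group"
  then have "frag_extend (\<lambda>(x, q). frag_of (f x, q)) r \<in> tensor_relators G' rat_group"
    unfolding tensor_relators_def Un_iff mem_Collect_eq
  proof (elim disjE exE conjE, goal_cases)
    case (1 x x' y)
    then show ?case
      using assms(3)
      by (intro disjI1 exI[of _ "f x"] exI[of _ "f x'"] exI[of _ y])
        (auto simp: hom_def frag_extend_diff)
  next
    case (2 x y y')
    then show ?case
      using assms(3)
      by (intro disjI2 exI[of _ "f x"] exI[of _ y] exI[of _ y'])
        (auto simp: hom_def frag_extend_diff)
  qed
  then show "frag_extend (\<lambda>(x, q). frag_of (f x, q)) r
      \<in> relator_span (carrier G' \<times> carrier rat_group) (tensor_relators G' rat_group)"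
    by (rule generate.incl)
qed

section \<open>The comparison homomorphisms respect the relations\<close>

lemma comm_group_character_group:
  assumes "field K" "group G"
  shows "comm_group (character_group G K)"
proof -
  interpret K: field K by fact
  interpret G: group G by fact
  interpret C: comm_group "units_of K"
    by (rule K.units_comm_group)
  have carrier: "c \<in> carrier (character_group G K) \<longleftrightarrow>
      c \<in> extensional (carrier G) \<and> (\<forall>x\<in>carrier G. c x \<in> carrier (units_of K)) \<and>
      (\<forall>x\<in>carrier G. \<forall>y\<in>carrier G. c (x \<otimes>\<^bsub>G\<^esub> y) = c x \<otimes>\<^bsub>units_of K\<^esub> c y)" for c
    unfolding character_group_def hom_def by auto
  have mult: "c \<otimes>\<^bsub>character_group G K\<^esub> d = (\<lambda>x\<in>carrier G. c x \<otimes>\<^bsub>units_of K\<^esub> d x)" for c d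
    by (simp add: character_group_def units_of_mult)
  have one: "\<one>\<^bsub>character_group G K\<^esub> = (\<lambda>x\<in>carrier G. \<one>\<^bsub>units_of K\<^esub>)"
    by (simp add: character_group_def units_of_one)
  show ?thesis
  proof (rule comm_groupI)
    fix c assume c: "c \<in> carrier (character_group G K)"
    let ?d = "\<lambda>x\<in>carrier G. inv\<^bsub>units_of K\<^esub> (c x)"
    have "?d \<in> carrier (character_group G K)"
      unfolding carrier
    proof (intro conjI ballI)
      show "?d x \<in> carrier (units_of K)" if "x \<in> carrier G" for x
        using c that C.inv_closed[of "c x"] by (simp only: carrier restrict_apply if_True)
      show "?d (x \<otimes>\<^bsub>G\<^esub> y) = ?d x \<otimes>\<^bsub>units_of K\<^esub> ?d y" if "x \<in> carrier G" "y \<in> carrier G" for x y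
        using c that C.inv_mult[of "c x" "c y"]
        by (simp only: carrier restrict_apply G.m_closed if_True)
    qed simp
    moreover have "?d \<otimes>\<^bsub>character_group G K\<^esub> c = \<one>\<^bsub>character_group G K\<^esub>"
      unfolding mult one
    proof (rule restrict_ext)
      show "?d x \<otimes>\<^bsub>units_of K\<^esub> c x = \<one>\<^bsub>units_of K\<^esub>" if "x \<in> carrier G" for x
        using c that C.l_inv[of "c x"] by (simp only: carrier restrict_apply if_True)
    qed
    ultimately show "\<exists>d\<in>carrier (character_group G K). d \<otimes>\<^bsub>character_group G K\<^esub> c = \<one>\<^bsub>character_group G K\<^esub>"
      by blast
  next
    fix c d assume c: "c \<in> carrier (character_group G K)" and d: "d \<in> carrier (character_group G K)"
    show "c \<otimes>\<^bsub>character_group G K\<^esub> d \<in> carrier (character_group G K)"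
      unfolding carrier mult
    proof (intro conjI ballI)
      fix x y assume xy: "x \<in> carrier G" "y \<in> carrier G"
      have "c x \<in> carrier (units_of K)" "d x \<in> carrier (units_of K)"
        "c y \<in> carrier (units_of K)" "d y \<in> carrier (units_of K)"
        using c d xy by (simp_all only: carrier)
      then have "(c x \<otimes>\<^bsub>units_of K\<^esub> c y) \<otimes>\<^bsub>units_of K\<^esub> (d x \<otimes>\<^bsub>units_of K\<^esub> d y)
          = (c x \<otimes>\<^bsub>units_of K\<^esub> d x) \<otimes>\<^bsub>units_of K\<^esub> (c y \<otimes>\<^bsub>units_of K\<^esub> d y)"
        by (simp only: C.m_ac C.m_closed)
      then show "(\<lambda>x\<in>carrier G. c x \<otimes>\<^bsub>units_of K\<^esub> d x) (x \<otimes>\<^bsub>G\<^esub> y)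
          = (\<lambda>x\<in>carrier G. c x \<otimes>\<^bsub>units_of K\<^esub> d x) x \<otimes>\<^bsub>units_of K\<^esub> (\<lambda>x\<in>carrier G. c x \<otimes>\<^bsub>units_of K\<^esub> d x) y"
        using c d xy by (simp only: carrier restrict_apply G.m_closed if_True)
    next
      fix x assume "x \<in> carrier G"
      then show "(\<lambda>x\<in>carrier G. c x \<otimes>\<^bsub>units_of K\<^esub> d x) x \<in> carrier (units_of K)"
        using c d C.m_closed[of "c x" "d x"] by (simp only: carrier restrict_apply if_True)
    qed simp
    show "c \<otimes>\<^bsub>character_group G K\<^esub> d = d \<otimes>\<^bsub>character_group G K\<^esub> c"
      unfolding mult using c d by (intro restrict_ext) (simp only: carrier C.m_comm)
    fix e assume e: "e \<in> carrier (character_group G K)"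
    show "c \<otimes>\<^bsub>character_group G K\<^esub> d \<otimes>\<^bsub>character_group G K\<^esub> e
        = c \<otimes>\<^bsub>character_group G K\<^esub> (d \<otimes>\<^bsub>character_group G K\<^esub> e)"
      unfolding mult
      using c d e by (intro restrict_ext) (simp only: carrier restrict_apply if_True C.m_assoc)
  next
    show "\<one>\<^bsub>character_group G K\<^esub> \<in> carrier (character_group G K)"
      unfolding carrier one
      by (intro conjI ballI) (simp_all only: restrict_apply if_True C.one_closed C.l_one G.m_closed restrict_extensional)
    fix c assume c: "c \<in> carrier (character_group G K)"
    have "(\<lambda>x\<in>carrier G. (\<lambda>x\<in>carrier G. \<one>\<^bsub>units_of K\<^esub>) x \<otimes>\<^bsub>units_of K\<^esub> c x) = (\<lambda>x\<in>carrier G. c x)"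
      using c by (intro restrict_ext) (simp only: carrier restrict_apply if_True C.l_one)
    then show "\<one>\<^bsub>character_group G K\<^esub> \<otimes>\<^bsub>character_group G K\<^esub> c = c"
      unfolding mult one using c by (simp only: carrier extensional_restrict)
  qed
qed

lemma symbols_exchange:
  assumes "group A" "s \<in> symbols n A" "size t = size s" "set_mset t \<subseteq> carrier A"
    and "set_mset s \<subseteq> generate A (set_mset t)"
  shows "t \<in> symbols n A"
proof -
  interpret A: group A by fact
  have "carrier A = generate A (set_mset s)" using assms(2) by (simp add: symbols_def)
  also have "\<dots> \<subseteq> generate A (set_mset t)"
    using assms(4,5) by (intro A.generate_subgroup_incl A.generate_is_subgroup)
  finally have "generate A (set_mset t) = carrier A"
    using A.generate_incl[OF assms(4)] by blast
  then show ?thesis using assms by (simp add: symbols_def)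
qed

lemma symbols_carrier:
  assumes "s \<in> symbols n A" "a \<in># s"
  shows "a \<in> carrier A"
  using assms by (auto simp: symbols_def)

lemma symbols_subtract1:
  assumes "group A" "{#a1, a2#} + b \<in> symbols n A"
  shows "{#a1, a2 \<otimes>\<^bsub>A\<^esub> inv\<^bsub>A\<^esub> a1#} + b \<in> symbols n A"
proof (rule symbols_exchange[OF assms])
  interpret A: group A by fact
  let ?t = "{#a1, a2 \<otimes>\<^bsub>A\<^esub> inv\<^bsub>A\<^esub> a1#} + b"
  have a: "a1 \<in> carrier A" "a2 \<in> carrier A" "set_mset b \<subseteq> carrier A"
    using symbols_carrier[OF assms(2)] by auto
  have "(a2 \<otimes>\<^bsub>A\<^esub> inv\<^bsub>A\<^esub> a1) \<otimes>\<^bsub>A\<^esub> a1 \<in> generate A (set_mset ?t)"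
    by (intro generate.eng generate.incl) auto
  then have "a2 \<in> generate A (set_mset ?t)" using a by (simp add: A.m_assoc)
  then show "set_mset ({#a1, a2#} + b) \<subseteq> generate A (set_mset ?t)"
    by (auto intro: generate.incl)
  show "set_mset ?t \<subseteq> carrier A" using a by auto
qed simp

lemma symbols_subtract2:
  assumes "group A" "{#a1, a2#} + b \<in> symbols n A"
  shows "{#a1 \<otimes>\<^bsub>A\<^esub> inv\<^bsub>A\<^esub> a2, a2#} + b \<in> symbols n A"
  using symbols_subtract1[of A a2 a1 b n] assms by (simp add: add_mset_commute)

lemma symbols_minus:
  assumes "group A" "{#a#} + b \<in> symbols n A"
  shows "{#inv\<^bsub>A\<^esub> a#} + b \<in> symbols n A"
proof (rule symbols_exchange[OF assms])
  interpret A: group A by fact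
  have a: "a \<in> carrier A" "set_mset b \<subseteq> carrier A"
    using symbols_carrier[OF assms(2)] by auto
  have "inv\<^bsub>A\<^esub> (inv\<^bsub>A\<^esub> a) \<in> generate A (set_mset ({#inv\<^bsub>A\<^esub> a#} + b))"
    by (rule generate.inv) simp
  then show "set_mset ({#a#} + b) \<subseteq> generate A (set_mset ({#inv\<^bsub>A\<^esub> a#} + b))"
    using a by (auto intro: generate.incl)
  show "set_mset ({#inv\<^bsub>A\<^esub> a#} + b) \<subseteq> carrier A" using a by auto
qed simp

lemma symbols_equal:
  assumes "group A" "{#a, a#} + b \<in> symbols n A"
  shows "{#\<one>\<^bsub>A\<^esub>, a#} + b \<in> symbols n A"
proof -
  have "a \<otimes>\<^bsub>A\<^esub> inv\<^bsub>A\<^esub> a = \<one>\<^bsub>A\<^esub>"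
    using symbols_carrier[OF assms(2)] assms(1) by (simp add: group.r_inv)
  then show ?thesis using symbols_subtract2[OF assms] by simp
qed

lemma subtract_relator_closed:
  assumes "group A" "{#a1, a2#} + b \<in> symbols n A"
  shows "subtract_relator A a1 a2 b \<in> carrier (free_Abelian_group (symbols n A))"
proof -
  have "Poly_Mapping.keys (subtract_relator A a1 a2 b) \<subseteq> symbols n A"
    unfolding subtract_relator_def
    by (rule order_trans[OF keys_frag_of_diff2])
      (use assms symbols_subtract1[OF assms] symbols_subtract2[OF assms] in blast)
  then show ?thesis by simp
qed

lemma B_relators_closed:
  assumes "group A"
  shows "B_relators n A \<subseteq> carrier (free_Abelian_group (symbols n A))"
proof -
  have "frag_of ({#a, a#} + b) - frag_of ({#\<one>\<^bsub>A\<^esub>, a#} + b) \<in> carrier (free_Abelian_group (symbols n A))"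
    if "{#a, a#} + b \<in> symbols n A" for a b
  proof -
    have "Poly_Mapping.keys (frag_of ({#a, a#} + b) - frag_of ({#\<one>\<^bsub>A\<^esub>, a#} + b)) \<subseteq> symbols n A"
      by (rule order_trans[OF keys_frag_of_diff]) (use that symbols_equal[OF assms that] in blast)
    then show ?thesis by simp
  qed
  then show ?thesis
    using subtract_relator_closed[OF assms] unfolding B_relators_def by blast
qed

lemma M_relators_closed:
  assumes "group A"
  shows "M_relators n A \<subseteq> carrier (free_Abelian_group (symbols n A))"
  using subtract_relator_closed[OF assms] unfolding M_relators_def by blast

lemma minus_relators_closed:
  assumes "group A"
  shows "minus_relators n A \<subseteq> carrier (free_Abelian_group (symbols n A))"
proof -
  have "frag_of ({#inv\<^bsub>A\<^esub> a#} + b) + frag_of ({#a#} + b) \<in> carrier (free_Abelian_group (symbols n A))"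
    if "{#a#} + b \<in> symbols n A" for a b
  proof -
    have "Poly_Mapping.keys (frag_of ({#inv\<^bsub>A\<^esub> a#} + b) + frag_of ({#a#} + b)) \<subseteq> symbols n A"
      by (rule order_trans[OF keys_add]) (use that symbols_minus[OF assms that] in auto)
    then show ?thesis by simp
  qed
  then show ?thesis unfolding minus_relators_def by blast
qed

lemma mu_symbol_closed:
  assumes "s \<in> symbols n A"
  shows "mu_symbol A s \<in> carrier (free_Abelian_group (symbols n A))"
  using assms keys_cmul[of 2 "frag_of s"] by (auto simp: mu_symbol_def)

lemma frag_cmul_diff: "frag_cmul k (x - y) = frag_cmul k x - frag_cmul k y"
  by (rule poly_mapping_eqI) (simp add: lookup_minus right_diff_distrib)

lemma frag_cmul_uminus: "frag_cmul k (- x) = frag_cmul (- k) x"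
  by (rule poly_mapping_eqI) simp

lemma span_cmul:
  assumes "R \<subseteq> carrier (free_Abelian_group S)" "x \<in> relator_span S R"
  shows "frag_cmul (int k) x \<in> relator_span S R"
  by (induction k)
    (use assms in \<open>auto simp: frag_cmul_distrib intro: span_zero span_add\<close>)

text \<open>The coefficient of \<^const>\<open>mu_symbol\<close> as a function of the number of zero entries.\<close>

definition mu_weight :: "nat \<Rightarrow> nat" where
  "mu_weight c = (if c = 0 then 1 else if c = 1 then 2 else 0)"

lemma mu_symbol_eq:
  "mu_symbol A s = frag_cmul (int (mu_weight (count s \<one>\<^bsub>A\<^esub>))) (frag_of s)"
  unfolding mu_symbol_def mu_weight_def by (simp only: split: if_split) simp

lemma mu_symbol_subtract:
  assumes "group A" "{#a1, a2#} + b \<in> symbols n A" "a1 \<noteq> a2"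
  shows "\<exists>k. frag_extend (mu_symbol A) (subtract_relator A a1 a2 b)
           = frag_cmul (int k) (subtract_relator A a1 a2 b)"
proof -
  interpret A: group A by fact
  have a: "a1 \<in> carrier A" "a2 \<in> carrier A"
    using symbols_carrier[OF assms(2)] by auto
  have ne: "a2 \<otimes>\<^bsub>A\<^esub> inv\<^bsub>A\<^esub> a1 \<noteq> \<one>\<^bsub>A\<^esub>" "a1 \<otimes>\<^bsub>A\<^esub> inv\<^bsub>A\<^esub> a2 \<noteq> \<one>\<^bsub>A\<^esub>"
    using a assms(3) A.inv_equality[of a2 "inv\<^bsub>A\<^esub> a1"] A.inv_equality[of a1 "inv\<^bsub>A\<^esub> a2"]
    by (metis A.inv_closed A.inv_inv)+
  have inv_ne: "inv\<^bsub>A\<^esub> a1 \<noteq> \<one>\<^bsub>A\<^esub>" if "a1 \<noteq> \<one>\<^bsub>A\<^esub>" using that a by (metis A.inv_inv A.inv_one)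
  have inv_ne': "inv\<^bsub>A\<^esub> a2 \<noteq> \<one>\<^bsub>A\<^esub>" if "a2 \<noteq> \<one>\<^bsub>A\<^esub>" using that a by (metis A.inv_inv A.inv_one)
  let ?k = "mu_weight (count b \<one>\<^bsub>A\<^esub>)"
  have "frag_extend (mu_symbol A) (subtract_relator A a1 a2 b)
      = frag_cmul (int ?k) (subtract_relator A a1 a2 b)"
    using assms(3) a ne inv_ne inv_ne'
    by (cases "a1 = \<one>\<^bsub>A\<^esub>"; cases "a2 = \<one>\<^bsub>A\<^esub>")
      (simp_all add: subtract_relator_def frag_extend_diff frag_extend_minus mu_symbol_eq
        frag_cmul_diff frag_cmul_uminus)
  then show ?thesis ..
qed

lemma mu_symbol_equal:
  assumes "group A" "{#a, a#} + b \<in> symbols n A"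
  shows "frag_extend (mu_symbol A) (frag_of ({#a, a#} + b) - frag_of ({#\<one>\<^bsub>A\<^esub>, a#} + b))
           \<in> relator_span (symbols n A) (M_relators n A)"
proof -
  interpret A: group A by fact
  note closed = M_relators_closed[OF assms(1)]
  have a: "a \<in> carrier A" using symbols_carrier[OF assms(2)] by auto
  let ?s = "frag_of ({#a, a#} + b)" and ?t = "frag_of ({#\<one>\<^bsub>A\<^esub>, a#} + b)"
  have rel: "subtract_relator A a a b \<in> relator_span (symbols n A) (M_relators n A)"
    using assms(2) unfolding M_relators_def by (blast intro: generate.incl)
  have rel_eq: "subtract_relator A a a b = ?s - ?t - ?t"
    using a by (simp add: subtract_relator_def add_mset_commute)
  consider "a = \<one>\<^bsub>A\<^esub>" | "a \<noteq> \<one>\<^bsub>A\<^esub>" "count b \<one>\<^bsub>A\<^esub> = 0" | "a \<noteq> \<one>\<^bsub>A\<^esub>" "count b \<one>\<^bsub>A\<^esub> = 1"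
    | "a \<noteq> \<one>\<^bsub>A\<^esub>" "count b \<one>\<^bsub>A\<^esub> \<ge> 2" by linarith
  then show ?thesis
  proof cases
    case 1
    then show ?thesis using span_zero[OF closed] by (simp add: frag_extend_diff)
  next
    case 2
    then have "frag_extend (mu_symbol A) (?s - ?t) = ?s - frag_cmul 2 ?t"
      by (simp add: frag_extend_diff mu_symbol_eq mu_weight_def)
    also have "\<dots> = subtract_relator A a a b"
      unfolding rel_eq using frag_cmul_distrib[of 1 1 ?t] by simp
    finally show ?thesis using rel by simp
  next
    case 3
    then obtain b' where b': "b = add_mset \<one>\<^bsub>A\<^esub> b'"
      by (metis count_eq_zero_iff multi_member_split zero_neq_one)
    have t: "{#\<one>\<^bsub>A\<^esub>, \<one>\<^bsub>A\<^esub>#} + add_mset a b' \<in> symbols n A"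
      using symbols_equal[OF assms] by (simp add: b' add_mset_commute)
    have "subtract_relator A \<one>\<^bsub>A\<^esub> \<one>\<^bsub>A\<^esub> (add_mset a b') = - ?t"
      by (simp add: subtract_relator_def b' add_mset_commute)
    moreover have "subtract_relator A \<one>\<^bsub>A\<^esub> \<one>\<^bsub>A\<^esub> (add_mset a b')
        \<in> relator_span (symbols n A) (M_relators n A)"
      using t unfolding M_relators_def by (blast intro: generate.incl)
    ultimately have "- ?t \<in> relator_span (symbols n A) (M_relators n A)" by simp
    then have "?t \<in> relator_span (symbols n A) (M_relators n A)"
      using span_minus[OF closed] by fastforce
    then have "(subtract_relator A a a b + ?t) + ?t \<in> relator_span (symbols n A) (M_relators n A)"
      using rel by (intro span_add[OF closed])
    then have "?s \<in> relator_span (symbols n A) (M_relators n A)"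
      by (simp add: rel_eq)
    then have "frag_cmul (int 2) ?s \<in> relator_span (symbols n A) (M_relators n A)"
      by (rule span_cmul[OF closed])
    moreover have "frag_extend (mu_symbol A) (?s - ?t) = frag_cmul 2 ?s"
      using 3 by (simp add: frag_extend_diff mu_symbol_eq mu_weight_def)
    ultimately show ?thesis by simp
  next
    case 4
    then have "frag_extend (mu_symbol A) (?s - ?t) = 0"
      by (simp add: frag_extend_diff mu_symbol_eq mu_weight_def)
    then show ?thesis using span_zero[OF closed] by simp
  qed
qed

lemma mu_symbol_B_relators:
  assumes "group A" "r \<in> B_relators n A"
  shows "frag_extend (mu_symbol A) r \<in> relator_span (symbols n A) (M_relators n A)"
  using assms(2) unfolding B_relators_def Un_iff mem_Collect_eq
proof (elim disjE exE conjE)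
  fix a1 a2 b
  assume r: "r = subtract_relator A a1 a2 b" and s: "{#a1, a2#} + b \<in> symbols n A" and "a1 \<noteq> a2"
  then obtain k where "frag_extend (mu_symbol A) r = frag_cmul (int k) r"
    using mu_symbol_subtract[OF assms(1)] by blast
  moreover have "r \<in> relator_span (symbols n A) (M_relators n A)"
    using r s unfolding M_relators_def by (blast intro: generate.incl)
  ultimately show ?thesis using span_cmul[OF M_relators_closed[OF assms(1)]] by simp
next
  fix a1 a2 b
  assume "r = frag_of ({#a1, a2#} + b) - frag_of ({#\<one>\<^bsub>A\<^esub>, a1#} + b)"
    "{#a1, a2#} + b \<in> symbols n A" "a1 = a2"
  then show ?thesis using mu_symbol_equal[OF assms(1)] by blast
qed

lemma mu_symbol_minus_relators:
  assumes "group A" "r \<in> minus_relators n A"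
  shows "frag_extend (mu_symbol A) r
           \<in> relator_span (symbols n A) (M_relators n A \<union> minus_relators n A)"
proof -
  interpret A: group A by fact
  obtain a b where r: "r = frag_of ({#inv\<^bsub>A\<^esub> a#} + b) + frag_of ({#a#} + b)"
    and s: "{#a#} + b \<in> symbols n A"
    using assms(2) by (auto simp: minus_relators_def)
  have a: "a \<in> carrier A" using symbols_carrier[OF s] by simp
  then have "inv\<^bsub>A\<^esub> a = \<one>\<^bsub>A\<^esub> \<longleftrightarrow> a = \<one>\<^bsub>A\<^esub>" by (metis A.inv_inv A.inv_one)
  then have eq: "count ({#inv\<^bsub>A\<^esub> a#} + b) \<one>\<^bsub>A\<^esub> = count ({#a#} + b) \<one>\<^bsub>A\<^esub>" by simp
  define k where "k = mu_weight (count ({#a#} + b) \<one>\<^bsub>A\<^esub>)"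
  have "frag_extend (mu_symbol A) r = frag_cmul (int k) r"
    unfolding r frag_extend_add frag_extend_of mu_symbol_eq eq k_def
    by (simp add: frag_cmul_distrib2)
  moreover have "r \<in> relator_span (symbols n A) (M_relators n A \<union> minus_relators n A)"
    using assms(2) by (blast intro: generate.incl)
  ultimately show ?thesis
    using span_cmul[of "M_relators n A \<union> minus_relators n A" "symbols n A" r k]
      M_relators_closed[OF assms(1)] minus_relators_closed[OF assms(1)] by simp
qed

lemma mu_hom:
  assumes "field K" "group G"
  shows "mu n G K \<in> hom (B_group n G K) (M_group n G K)"
proof -
  have A: "group (character_group G K)"
    using comm_group_character_group[OF assms] by (rule comm_group.axioms)
  show ?thesis
    unfolding mu_def B_group_def M_group_def
    by (intro presented_map_hom B_relators_closed M_relators_closed mu_symbol_closed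
        mu_symbol_B_relators A)
qed

lemma mu_minus_hom:
  assumes "field K" "group G"
  shows "mu_minus n G K \<in> hom (B_minus_group n G K) (M_minus_group n G K)"
proof -
  let ?A = "character_group G K"
  have A: "group ?A"
    using comm_group_character_group[OF assms] by (rule comm_group.axioms)
  have "frag_extend (mu_symbol ?A) r
      \<in> relator_span (symbols n ?A) (M_relators n ?A \<union> minus_relators n ?A)"
    if "r \<in> B_relators n ?A \<union> minus_relators n ?A" for r
    using that mu_symbol_B_relators[OF A] mu_symbol_minus_relators[OF A]
      group.mono_generate[OF group_free_Abelian_group Un_upper1, of "symbols n ?A" "M_relators n ?A" "minus_relators n ?A"]
    by blast
  then show ?thesis
    unfolding mu_minus_def B_minus_group_def M_minus_group_def
    by (intro presented_map_hom Un_least B_relators_closed M_relators_closed minus_relators_closed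
        mu_symbol_closed A)
qed

end

(*
Up to the scalar 2 the inverse of mu has weights 2, 1, 0 on symbols with 0, 1, at least 2 zero
entries. It respects the relations rationally once symbols with two zero entries are torsion in
B_n. To see this, let z be nonzero of order N, let H be the group generated by z, and put
g(x, y) = [x, y, z, ...] for x, y in H. Two instances of the subtraction relation show that
g(x, y) + g(-x, y) does not change under x -> x + z, hence equals its value g(0, y) at x = z for
all nonzero x, and so 2 sum_x g(x, y) = (N + 1) g(0, y). Summing the relations over all x, y in H
gives sum_{x,y} g(x, y) = sum_y g(0, y) =: U. Thus (N - 1) U = 0, while 2 U = (N + 1) g(0, 0), and
(N^2 - 1) [0, 0, z, ...] = 0.
*)

theory Submission
  imports Defs
begin

text \<open>The weights reflect the one difference between the presentations: equal entries give
  \<open>[a,a,...] = [0,a,...]\<close> in B_n but \<open>2 [0,a,...]\<close> in M_n. Any map that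
  scales a symbol by a function of its number of zeros sends sign relators, and subtraction relators
  with unequal entries, to multiples of themselves. The obstacle is a relation of M_n with equal
  nonzero entries beside exactly one zero. The inverse weights of its symbols are 1 and 0, so B_n
  would have to kill \<open>[a,a,0,...] = [0,a,0,...]\<close>, a symbol with two zeros; hence the
  torsion statement. That statement needs a nonzero entry z of finite order. A symbol without
  nonzero entries generates the trivial group, so A must be nontrivial; algebraic closedness and
  characteristic zero serve to produce a nontrivial character. Everything before tensoring is
  integral: a common torsion exponent, multiplied into the inverse weights, gives an honest
  homomorphism from M_n to B_n, and both composites with mu are multiplication by one positive
  integer, which Q inverts.\<close>

section \<open>Relator spans and linear extensions\<close>

lemma span_diff:
  assumes "R \<subseteq> carrier (free_Abelian_group S)" "x \<in> relator_span S R" "y \<in> relator_span S R"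
  shows "x - y \<in> relator_span S R"
  using span_add[OF assms(1,2) span_minus[OF assms(1,3)]] by simp

lemma span_cmul_int:
  assumes "R \<subseteq> carrier (free_Abelian_group S)" "x \<in> relator_span S R"
  shows "frag_cmul k x \<in> relator_span S R"
proof (cases k)
  case (nonneg n)
  then show ?thesis using span_cmul[OF assms] by simp
next
  case (neg n)
  then show ?thesis
    using span_minus[OF assms(1) span_cmul[OF assms, of "Suc n"]] by simp
qed

lemma span_sum:
  assumes "R \<subseteq> carrier (free_Abelian_group S)" "\<And>i. i \<in> I \<Longrightarrow> f i \<in> relator_span S R"
  shows "sum f I \<in> relator_span S R"
  using assms(2)
proof (induction I rule: infinite_finite_induct)
  case (insert i I)
  then have "f i + sum f I \<in> relator_span S R"
    by (intro span_add[OF assms(1)]) blast+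
  then show ?case using insert by simp
qed (use span_zero[OF assms(1)] in simp_all)

lemma frag_extend_span_cong:
  assumes "R \<subseteq> carrier (free_Abelian_group S)"
    and "\<And>s. s \<in> S' \<Longrightarrow> p s - q s \<in> relator_span S R"
    and "c \<in> carrier (free_Abelian_group S')"
  shows "frag_extend p c - frag_extend q c \<in> relator_span S R"
proof -
  have "frag_extend p c - frag_extend q c
      = (\<Sum>s\<in>Poly_Mapping.keys c. frag_cmul (Poly_Mapping.lookup c s) (p s - q s))"
    unfolding frag_extend_def frag_cmul_diff by (rule sum_subtractf[symmetric])
  also have "\<dots> \<in> relator_span S R"
    using assms by (intro span_sum span_cmul_int) auto
  finally show ?thesis .
qed

lemma frag_extend_frag_extend:
  "frag_extend p (frag_extend q c) = frag_extend (\<lambda>s. frag_extend p (q s)) c"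
  by (simp add: frag_extend_def[of q] frag_extend_def[of "\<lambda>s. frag_extend p (q s)"]
      frag_extend_sum frag_extend_cmul o_def)

lemma frag_extend_frag_cmul: "frag_extend (\<lambda>s. frag_cmul k (frag_of s)) c = frag_cmul k c"
proof -
  have "frag_extend (\<lambda>s. frag_cmul k (frag_of s)) c = frag_cmul k (frag_extend frag_of c)"
    by (simp add: frag_extend_def frag_cmul_sum mult.commute)
  then show ?thesis by (simp add: frag_expansion[symmetric])
qed

section \<open>Mutually inverse maps of presented groups\<close>

lemma presented_class_eq_iff:
  assumes "R \<subseteq> carrier (free_Abelian_group S)"
    and "c \<in> carrier (free_Abelian_group S)" "d \<in> carrier (free_Abelian_group S)"
  shows "presented_class S R c = presented_class S R d \<longleftrightarrow> c - d \<in> relator_span S R"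
proof
  assume "presented_class S R c = presented_class S R d"
  moreover have "c \<in> presented_class S R c"
    unfolding presented_class_def
    using group.rcos_self[OF group_free_Abelian_group assms(2) subgroup_span[OF assms(1)]] .
  ultimately have "c \<in> presented_class S R d" by simp
  then show "c - d \<in> relator_span S R"
    by (auto simp: presented_class_def r_coset_def)
next
  assume "c - d \<in> relator_span S R"
  then have "c \<in> presented_class S R d"
    unfolding presented_class_def r_coset_def
    by (auto intro!: bexI[of _ "c - d"])
  then show "presented_class S R c = presented_class S R d"
    unfolding presented_class_def
    using group.repr_independence[OF group_free_Abelian_group _ assms(3) subgroup_span[OF assms(1)]]
    by metis
qed

text \<open>Linearity reduces the claim to single symbols, and there a congruence modulo the
  relators suffices. The multiple is kept general: 1 serves for honest inverses,
  \<open>2 * torsion_bound e\<close> for the comparison maps.\<close>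

lemma presented_map_comp_class:
  assumes "R \<subseteq> carrier (free_Abelian_group S)" "R' \<subseteq> carrier (free_Abelian_group S')"
    and h: "\<And>s. s \<in> S \<Longrightarrow> h s \<in> carrier (free_Abelian_group S')"
    and h': "\<And>s. s \<in> S' \<Longrightarrow> h' s \<in> carrier (free_Abelian_group S)"
    and rel: "\<And>r. r \<in> R \<Longrightarrow> frag_extend h r \<in> relator_span S' R'"
    and rel': "\<And>r. r \<in> R' \<Longrightarrow> frag_extend h' r \<in> relator_span S R"
    and comp: "\<And>s. s \<in> S \<Longrightarrow> frag_extend h' (h s) - frag_cmul m (frag_of s) \<in> relator_span S R"
    and c: "c \<in> carrier (free_Abelian_group S)"
  shows "presented_map S R h' (presented_map S' R' h (presented_class S R c))
    = presented_class S R (frag_cmul m c)"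
proof -
  have hc: "frag_extend h c \<in> carrier (free_Abelian_group S')"
    using frag_extend_closed[OF h c] .
  have "presented_map S R h' (presented_map S' R' h (presented_class S R c))
    = presented_class S R (frag_extend h' (frag_extend h c))"
    using presented_map_class[OF assms(1,2) h rel c] presented_map_class[OF assms(2,1) h' rel' hc]
    by simp
  also have "\<dots> = presented_class S R (frag_cmul m c)"
  proof (subst presented_class_eq_iff[OF assms(1)])
    show "frag_extend h' (frag_extend h c) \<in> carrier (free_Abelian_group S)"
      using frag_extend_closed[OF h' hc] .
    show "frag_cmul m c \<in> carrier (free_Abelian_group S)"
      using c keys_cmul[of m c] by auto
    show "frag_extend h' (frag_extend h c) - frag_cmul m c \<in> relator_span S R"
      using frag_extend_span_cong[of R S S "\<lambda>s. frag_extend h' (h s)", OF assms(1) comp c]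
      by (simp add: frag_extend_frag_extend frag_extend_frag_cmul)
  qed
  finally show ?thesis .
qed

text \<open>Applied to the presentations of the tensor products themselves, where the multiple
  \<open>m\<close> has become invertible.\<close>

lemma presented_map_iso:
  assumes "R \<subseteq> carrier (free_Abelian_group S)" "R' \<subseteq> carrier (free_Abelian_group S')"
    and h: "\<And>s. s \<in> S \<Longrightarrow> h s \<in> carrier (free_Abelian_group S')"
    and h': "\<And>s. s \<in> S' \<Longrightarrow> h' s \<in> carrier (free_Abelian_group S)"
    and rel: "\<And>r. r \<in> R \<Longrightarrow> frag_extend h r \<in> relator_span S' R'"
    and rel': "\<And>r. r \<in> R' \<Longrightarrow> frag_extend h' r \<in> relator_span S R"
    and comp: "\<And>s. s \<in> S \<Longrightarrow> frag_extend h' (h s) - frag_of s \<in> relator_span S R"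
    and comp': "\<And>s. s \<in> S' \<Longrightarrow> frag_extend h (h' s) - frag_of s \<in> relator_span S' R'"
  shows "presented_map S' R' h \<in> iso (presented_group S R) (presented_group S' R')"
proof (rule isoI)
  show hom: "presented_map S' R' h \<in> hom (presented_group S R) (presented_group S' R')"
    by (rule presented_map_hom[OF assms(1,2) h rel])
  have hom': "presented_map S R h' \<in> hom (presented_group S' R') (presented_group S R)"
    by (rule presented_map_hom[OF assms(2,1) h' rel'])
  have "presented_map S R h' (presented_map S' R' h U) = U"
    if "U \<in> carrier (presented_group S R)" for U
    using that presented_map_comp_class[OF assms(1,2) h h' rel rel', of 1] comp
    unfolding carrier_presented_group by fastforce
  moreover have "presented_map S' R' h (presented_map S R h' U) = U"
    if "U \<in> carrier (presented_group S' R')" for U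
    using that presented_map_comp_class[OF assms(2,1) h' h rel' rel, of 1] comp'
    unfolding carrier_presented_group by fastforce
  ultimately show "bij_betw (presented_map S' R' h)
      (carrier (presented_group S R)) (carrier (presented_group S' R'))"
    using hom hom' by (intro bij_betw_byWitness[where f' = "presented_map S R h'"]) (auto simp: hom_def)
qed

lemma presented_class_pow:
  assumes "R \<subseteq> carrier (free_Abelian_group S)" "c \<in> carrier (free_Abelian_group S)"
  shows "presented_class S R c [^]\<^bsub>presented_group S R\<^esub> (m :: nat)
    = presented_class S R (frag_cmul (int m) c)"
proof (induction m)
  case 0
  have "\<one>\<^bsub>presented_group S R\<^esub> = presented_class S R 0"
    using group.coset_join2[OF group_free_Abelian_group _ subgroup_span[OF assms(1)], of 0]
      span_zero[OF assms(1)]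
    by (simp add: presented_group_def presented_class_def FactGroup_def)
  then show ?case by simp
next
  case (Suc m)
  have "frag_cmul (int m) c \<in> carrier (free_Abelian_group S)"
    using assms(2) keys_cmul[of "int m" c] by auto
  then show ?case
    using Suc mult_presented_class[OF assms(1) _ assms(2)]
    by (simp add: frag_cmul_distrib add.commute)
qed

section \<open>Tensoring with the rationals\<close>

text \<open>Moves a multiple from the group factor to the rational factor, where division can undo
  it.\<close>

lemma tensor_rat_pow:
  assumes "group G" "x \<in> carrier G"
  shows "frag_of (x [^]\<^bsub>G\<^esub> (m :: nat), q) - frag_of (x, of_nat m * q)
    \<in> relator_span (carrier G \<times> carrier rat_group) (tensor_relators G rat_group)"
    (is "_ \<in> ?I")
proof (induction m)
  interpret G: group G by fact
  note closed = tensor_relators_closed[OF assms(1) group_rat_group]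
  have rel1: "frag_of (x \<otimes>\<^bsub>G\<^esub> y, q) - frag_of (x, q) - frag_of (y, q) \<in> ?I"
    if "x \<in> carrier G" "y \<in> carrier G" for x y q
    using that by (intro generate.incl) (auto simp: tensor_relators_def rat_group_def)
  have rel2: "frag_of (x, q + r) - frag_of (x, q) - frag_of (x, r) \<in> ?I" for q r
    using assms(2) by (intro generate.incl) (auto simp: tensor_relators_def rat_group_def)
  {
    case 0
    \<comment> \<open>Bilinearity for a product of two neutral elements collapses to the negative of
      one symbol, so symbols with a neutral factor lie in the span.\<close>
    have "- frag_of (\<one>\<^bsub>G\<^esub>, q) \<in> ?I" using rel1[of "\<one>\<^bsub>G\<^esub>" "\<one>\<^bsub>G\<^esub>" q] by simp
    moreover have "- frag_of (x, 0) \<in> ?I" using rel2[of 0 0] by simp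
    ultimately show ?case using span_diff[OF closed] by fastforce
  next
    case (Suc m)
    have "frag_of (x [^]\<^bsub>G\<^esub> Suc m, q) - frag_of (x [^]\<^bsub>G\<^esub> m, q) - frag_of (x, q) \<in> ?I"
      using rel1[of "x [^]\<^bsub>G\<^esub> m" x q] assms(2) by simp
    then have "(frag_of (x [^]\<^bsub>G\<^esub> Suc m, q) - frag_of (x [^]\<^bsub>G\<^esub> m, q) - frag_of (x, q))
      - (frag_of (x, of_nat m * q + q) - frag_of (x, of_nat m * q) - frag_of (x, q))
      + (frag_of (x [^]\<^bsub>G\<^esub> m, q) - frag_of (x, of_nat m * q)) \<in> ?I"
      by (rule span_add[OF closed span_diff[OF closed _ rel2] Suc])
    then show ?case by (simp add: algebra_simps)
  }
qed

text \<open>The inverse is \<open>k\<close> tensored with division by \<open>m\<close>: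
  \<open>k (f x)\<close> tensor \<open>q / m\<close> is the \<open>m\<close>-fold multiple of
  \<open>x\<close> tensor \<open>q / m\<close>, hence \<open>x\<close> tensor
  \<open>q\<close>.\<close>

lemma tensor_rat_map_iso:
  assumes "group G" "group G'" "f \<in> hom G G'" "k \<in> hom G' G" "m > (0 :: nat)"
    and kf: "\<And>x. x \<in> carrier G \<Longrightarrow> k (f x) = x [^]\<^bsub>G\<^esub> m"
    and fk: "\<And>y. y \<in> carrier G' \<Longrightarrow> f (k y) = y [^]\<^bsub>G'\<^esub> m"
  shows "tensor_rat_map G' f \<in> iso (tensor_rat G) (tensor_rat G')"
proof -
  \<comment> \<open>Division by \<open>c\<close> is additive, so one computation covers
    \<open>f\<close> with \<open>c = 1\<close> and \<open>k\<close> with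
    \<open>c = m\<close>.\<close>
  have rel: "frag_extend (\<lambda>(x, q). frag_of (u x, q / c)) r
      \<in> relator_span (carrier H' \<times> carrier rat_group) (tensor_relators H' rat_group)"
    if "u \<in> hom H H'" "r \<in> tensor_relators H rat_group"
    for u :: "'x \<Rightarrow> 'y" and c r and H :: "('x, 'p) monoid_scheme" and H' :: "('y, 'q) monoid_scheme"
  proof (rule generate.incl)
    show "frag_extend (\<lambda>(x, q). frag_of (u x, q / c)) r \<in> tensor_relators H' rat_group"
      using that(2) unfolding tensor_relators_def Un_iff mem_Collect_eq
    proof (elim disjE exE conjE, goal_cases)
      case (1 x x' y)
      then show ?case
        using that(1)
        by (intro disjI1 exI[of _ "u x"] exI[of _ "u x'"] exI[of _ "y / c"])
          (auto simp: hom_def frag_extend_diff rat_group_def)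
    next
      case (2 x y y')
      then show ?case
        using that(1)
        by (intro disjI2 exI[of _ "u x"] exI[of _ "y / c"] exI[of _ "y' / c"])
          (auto simp: hom_def frag_extend_diff rat_group_def add_divide_distrib)
    qed
  qed
  have f: "f x \<in> carrier G'" if "x \<in> carrier G" for x using assms(3) that by (auto simp: hom_def)
  have k: "k x \<in> carrier G" if "x \<in> carrier G'" for x using assms(4) that by (auto simp: hom_def)
  show ?thesis
    unfolding tensor_rat_map_def tensor_group_def
  proof (rule presented_map_iso[where h' = "\<lambda>(y, q). frag_of (k y, q / of_nat m)",
        OF tensor_relators_closed[OF assms(1) group_rat_group]
          tensor_relators_closed[OF assms(2) group_rat_group]], goal_cases)
    case (1 s)
    then show ?case using f by auto
  next
    case (2 s)
    then show ?case using k by (auto simp: rat_group_def)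
  next
    case (3 r)
    then show ?case using rel[OF assms(3) 3, of 1] by simp
  next
    case (4 r)
    then show ?case by (rule rel[OF assms(4)])
  next
    case (5 s)
    then show ?case
      using tensor_rat_pow[OF assms(1), of "fst s" m "snd s / of_nat m"] kf assms(5) by auto
  next
    case (6 s)
    then show ?case
      using tensor_rat_pow[OF assms(2), of "fst s" m "snd s / of_nat m"] fk assms(5) by auto
  qed
qed

text \<open>Reduces a rational isomorphism to integral checks on symbols and relators;
  \<open>presented_class_pow\<close> turns multiples of representatives into the powers that
  \<open>tensor_rat_map_iso\<close> asks for.\<close>

lemma tensor_rat_presented_map_iso:
  assumes "R \<subseteq> carrier (free_Abelian_group S)" "R' \<subseteq> carrier (free_Abelian_group S')"
    and h: "\<And>s. s \<in> S \<Longrightarrow> h s \<in> carrier (free_Abelian_group S')"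
    and h': "\<And>s. s \<in> S' \<Longrightarrow> h' s \<in> carrier (free_Abelian_group S)"
    and rel: "\<And>r. r \<in> R \<Longrightarrow> frag_extend h r \<in> relator_span S' R'"
    and rel': "\<And>r. r \<in> R' \<Longrightarrow> frag_extend h' r \<in> relator_span S R"
    and "m > (0 :: nat)"
    and comp: "\<And>s. s \<in> S \<Longrightarrow>
      frag_extend h' (h s) - frag_cmul (int m) (frag_of s) \<in> relator_span S R"
    and comp': "\<And>s. s \<in> S' \<Longrightarrow>
      frag_extend h (h' s) - frag_cmul (int m) (frag_of s) \<in> relator_span S' R'"
  shows "tensor_rat_map (presented_group S' R') (presented_map S' R' h)
    \<in> iso (tensor_rat (presented_group S R)) (tensor_rat (presented_group S' R'))"
proof (rule tensor_rat_map_iso[where m = m and k = "presented_map S R h'"])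
  show "group (presented_group S R)" "group (presented_group S' R')"
    using comm_group_presented_group assms(1,2) by (auto intro: comm_group.axioms)
  show "presented_map S' R' h \<in> hom (presented_group S R) (presented_group S' R')"
    by (rule presented_map_hom[OF assms(1,2) h rel])
  show "presented_map S R h' \<in> hom (presented_group S' R') (presented_group S R)"
    by (rule presented_map_hom[OF assms(2,1) h' rel'])
  show "m > 0" by fact
  show "presented_map S R h' (presented_map S' R' h U) = U [^]\<^bsub>presented_group S R\<^esub> m"
    if "U \<in> carrier (presented_group S R)" for U
    using that presented_map_comp_class[OF assms(1,2) h h' rel rel' comp]
      presented_class_pow[OF assms(1)]
    unfolding carrier_presented_group by fastforce
  show "presented_map S' R' h (presented_map S R h' U) = U [^]\<^bsub>presented_group S' R'\<^esub> m"
    if "U \<in> carrier (presented_group S' R')" for U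
    using that presented_map_comp_class[OF assms(2,1) h' h rel' rel comp']
      presented_class_pow[OF assms(2)]
    unfolding carrier_presented_group by fastforce
qed

section \<open>Torsion of symbols with two zeros\<close>

lemma sum_const_frag_cmul: "(\<Sum>x\<in>B. c) = frag_cmul (int (card B)) (c :: 'a \<Rightarrow>\<^sub>0 int)"
  by (induction B rule: infinite_finite_induct) (simp_all add: frag_cmul_distrib)

text \<open>\<open>R\<close> may be any set of relators containing those of B_n, so that the same
  computation serves B_n and its minus quotient.\<close>

lemma double_zero_torsion:
  fixes A :: "('a, 'm) monoid_scheme" and n :: nat
  defines "S \<equiv> symbols n A"
  assumes "comm_group A" and R: "B_relators n A \<subseteq> R" "R \<subseteq> carrier (free_Abelian_group S)"
    and s: "{#\<one>\<^bsub>A\<^esub>, \<one>\<^bsub>A\<^esub>, z#} + b \<in> S" and z: "z \<noteq> \<one>\<^bsub>A\<^esub>"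
    and fin: "finite (generate A {z})"
  shows "frag_cmul (int (card (generate A {z})) ^ 2 - 1) (frag_of ({#\<one>\<^bsub>A\<^esub>, \<one>\<^bsub>A\<^esub>, z#} + b))
    \<in> relator_span S R"
proof -
  interpret A: comm_group A by fact
  have grp: "group A" by (rule A.group_axioms)
  define I where "I = relator_span S R"
  define H where "H = generate A {z}"
  define N where "N = int (card H)"
  \<comment> \<open>With \<open>z\<close> kept as third entry, \<open>g x y\<close> is a symbol for
    all \<open>x\<close> and \<open>y\<close> in \<open>H\<close>: the two entries being replaced
    are trivial and contribute nothing to the generated group.\<close>
  define g where "g x y = frag_of ({#x, y, z#} + b)" for x y
  have zA: "z \<in> carrier A" using s by (auto simp: S_def symbols_def)
  interpret H: subgroup H A unfolding H_def by (rule A.generate_is_subgroup) (use zA in simp)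
  have finH: "finite H" using fin by (simp add: H_def)
  have HA: "x \<in> carrier A" if "x \<in> H" for x using that H.subset by blast
  have zH: "z \<in> H" unfolding H_def by (rule generate.incl) simp
  have I_add: "u + v \<in> I" if "u \<in> I" "v \<in> I" for u v
    using span_add[OF R(2)] that unfolding I_def by blast
  have I_diff: "u - v \<in> I" if "u \<in> I" "v \<in> I" for u v
    using span_diff[OF R(2)] that unfolding I_def by blast
  have I_cmul: "frag_cmul k u \<in> I" if "u \<in> I" for u k
    using span_cmul_int[OF R(2)] that unfolding I_def by blast
  have I_sum: "sum f B \<in> I" if "\<And>x. x \<in> B \<Longrightarrow> f x \<in> I" for f :: "'a \<Rightarrow> _" and B
    using span_sum[OF R(2)] that unfolding I_def by blast
  have sym: "{#x, y, z#} + b \<in> S" if "x \<in> H" "y \<in> H" for x y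
    unfolding S_def
  proof (rule symbols_exchange[OF grp s[unfolded S_def]])
    show "set_mset ({#x, y, z#} + b) \<subseteq> carrier A"
      using s HA that by (auto simp: S_def symbols_def)
    show "set_mset ({#\<one>\<^bsub>A\<^esub>, \<one>\<^bsub>A\<^esub>, z#} + b) \<subseteq> generate A (set_mset ({#x, y, z#} + b))"
      by (auto intro: generate.incl generate.one)
  qed simp
  have rel: "frag_of ({#x, y#} + c) - frag_of ({#x, y \<otimes>\<^bsub>A\<^esub> inv\<^bsub>A\<^esub> x#} + c)
      - frag_of ({#x \<otimes>\<^bsub>A\<^esub> inv\<^bsub>A\<^esub> y, y#} + c) \<in> I"
    if "{#x, y#} + c \<in> S" "x \<noteq> y" for x y c
    unfolding I_def
    by (rule generate.incl, rule subsetD[OF R(1)])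
      (use that in \<open>unfold B_relators_def subtract_relator_def S_def, blast\<close>)
  have rel_eq: "frag_of ({#x, x#} + c) - frag_of ({#\<one>\<^bsub>A\<^esub>, x#} + c) \<in> I"
    if "{#x, x#} + c \<in> S" for x c
    unfolding I_def
    by (rule generate.incl, rule subsetD[OF R(1)])
      (use that in \<open>unfold B_relators_def S_def, blast\<close>)
  have g_sym: "g x y = g y x" for x y
    by (simp add: g_def add_mset_commute)
  have g_rel: "g x y - g x (y \<otimes>\<^bsub>A\<^esub> inv\<^bsub>A\<^esub> x) - g (x \<otimes>\<^bsub>A\<^esub> inv\<^bsub>A\<^esub> y) y \<in> I"
    if "x \<in> H" "y \<in> H" "x \<noteq> y" for x y
    using rel[of x y "add_mset z b"] sym[of x y] that by (simp add: g_def add_mset_commute)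
  have g_eq: "g x x - g \<one>\<^bsub>A\<^esub> x \<in> I" if "x \<in> H" for x
    using rel_eq[of x "add_mset z b"] sym[of x x] that by (simp add: g_def add_mset_commute)

  define \<delta> where "\<delta> x y = g x y + g (inv\<^bsub>A\<^esub> x) y" for x y
  have \<delta>_shift: "\<delta> (x \<otimes>\<^bsub>A\<^esub> z) y - \<delta> x y \<in> I"
    if xy: "x \<in> H" "y \<in> H" and ne: "x \<noteq> \<one>\<^bsub>A\<^esub>" "x \<otimes>\<^bsub>A\<^esub> z \<noteq> \<one>\<^bsub>A\<^esub>" for x y
  proof -
    \<comment> \<open>Additively this is \<open>[-x, x+z, y, b]\<close>. It occurs in the relation
      for the entries \<open>x+z, z\<close> and in the one for \<open>-x, z\<close>, and cancels in
      their difference. The two conditions on \<open>x\<close> say that these pairs are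
      unequal.\<close>
    define w where "w = frag_of ({#inv\<^bsub>A\<^esub> x, x \<otimes>\<^bsub>A\<^esub> z, y#} + b)"
    note c = HA[OF xy(1)] HA[OF xy(2)] zA
    have "x \<otimes>\<^bsub>A\<^esub> z \<noteq> z" "inv\<^bsub>A\<^esub> x \<noteq> z"
      using c ne A.r_cancel_one[of z x] A.r_inv[of x] by auto
    moreover have "{#x \<otimes>\<^bsub>A\<^esub> z, z#} + add_mset y b \<in> S" "{#inv\<^bsub>A\<^esub> x, z#} + add_mset y b \<in> S"
      using sym[of "x \<otimes>\<^bsub>A\<^esub> z" y] sym[of "inv\<^bsub>A\<^esub> x" y] xy zH by (simp_all add: add_mset_commute)
    ultimately have
      "frag_of ({#x \<otimes>\<^bsub>A\<^esub> z, z#} + add_mset y b) - frag_of ({#x \<otimes>\<^bsub>A\<^esub> z, z \<otimes>\<^bsub>A\<^esub> inv\<^bsub>A\<^esub> (x \<otimes>\<^bsub>A\<^esub> z)#} + add_mset y b)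
        - frag_of ({#x \<otimes>\<^bsub>A\<^esub> z \<otimes>\<^bsub>A\<^esub> inv\<^bsub>A\<^esub> z, z#} + add_mset y b) \<in> I"
      "frag_of ({#inv\<^bsub>A\<^esub> x, z#} + add_mset y b) - frag_of ({#inv\<^bsub>A\<^esub> x, z \<otimes>\<^bsub>A\<^esub> inv\<^bsub>A\<^esub> (inv\<^bsub>A\<^esub> x)#} + add_mset y b)
        - frag_of ({#inv\<^bsub>A\<^esub> x \<otimes>\<^bsub>A\<^esub> inv\<^bsub>A\<^esub> z, z#} + add_mset y b) \<in> I"
      using rel by blast+
    moreover have "z \<otimes>\<^bsub>A\<^esub> inv\<^bsub>A\<^esub> (x \<otimes>\<^bsub>A\<^esub> z) = inv\<^bsub>A\<^esub> x" "x \<otimes>\<^bsub>A\<^esub> z \<otimes>\<^bsub>A\<^esub> inv\<^bsub>A\<^esub> z = x"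
      "z \<otimes>\<^bsub>A\<^esub> inv\<^bsub>A\<^esub> (inv\<^bsub>A\<^esub> x) = x \<otimes>\<^bsub>A\<^esub> z" "inv\<^bsub>A\<^esub> x \<otimes>\<^bsub>A\<^esub> inv\<^bsub>A\<^esub> z = inv\<^bsub>A\<^esub> (x \<otimes>\<^bsub>A\<^esub> z)"
      using c by (simp_all add: A.inv_mult A.m_assoc A.m_lcomm[of z "inv\<^bsub>A\<^esub> x"] A.m_comm[of z x])
    ultimately have "g (x \<otimes>\<^bsub>A\<^esub> z) y - w - g x y \<in> I"
      "g (inv\<^bsub>A\<^esub> x) y - w - g (inv\<^bsub>A\<^esub> (x \<otimes>\<^bsub>A\<^esub> z)) y \<in> I"
      by (simp_all add: g_def w_def add_mset_commute)
    from I_diff[OF this] show ?thesis by (simp add: \<delta>_def algebra_simps)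
  qed
  have \<delta>_z: "\<delta> z y - g \<one>\<^bsub>A\<^esub> y \<in> I" if "y \<in> H" for y
  proof -
    \<comment> \<open>The shift cannot start at \<open>x = 0\<close>. Instead, equal entries
      \<open>z, z\<close> give \<open>g z y\<close>, while the relation for \<open>0, z\<close>
      repeats its left side on the right and so kills \<open>[-z, z, y, b]\<close>.\<close>
    have "{#z, z#} + add_mset y b \<in> S" "{#\<one>\<^bsub>A\<^esub>, z#} + add_mset y b \<in> S"
      using sym[of z y] sym[of "\<one>\<^bsub>A\<^esub>" y] zH that by (simp_all add: add_mset_commute)
    then have "g z y - g \<one>\<^bsub>A\<^esub> y \<in> I" "- g (inv\<^bsub>A\<^esub> z) y \<in> I"
      using rel_eq[of z "add_mset y b"] rel[of "\<one>\<^bsub>A\<^esub>" z "add_mset y b"] z zA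
      by (simp_all add: g_def add_mset_commute)
    from I_diff[OF this] show ?thesis by (simp add: \<delta>_def algebra_simps)
  qed
  have \<delta>_pow: "z [^]\<^bsub>A\<^esub> i \<noteq> \<one>\<^bsub>A\<^esub> \<Longrightarrow> \<delta> (z [^]\<^bsub>A\<^esub> i) y - g \<one>\<^bsub>A\<^esub> y \<in> I" if "y \<in> H" for i :: nat and y
  proof (induction i)
    case (Suc i)
    show ?case
    proof (cases "z [^]\<^bsub>A\<^esub> i = \<one>\<^bsub>A\<^esub>")
      \<comment> \<open>A power returning to the identity restarts the orbit: the next power is
        \<open>z\<close> itself, where no shift is available.\<close>
      case True
      then show ?thesis using \<delta>_z[OF that] zA by simp
    next
      case False
      have "z [^]\<^bsub>A\<^esub> i \<in> H" by (induction i) (simp_all add: zH)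
      moreover have "z [^]\<^bsub>A\<^esub> i \<otimes>\<^bsub>A\<^esub> z \<noteq> \<one>\<^bsub>A\<^esub>" using Suc.prems by simp
      ultimately show ?thesis
        using I_add[OF \<delta>_shift[OF _ that False] Suc.IH[OF False]] by simp
    qed
  qed simp
  have \<delta>_eq: "\<delta> x y - g \<one>\<^bsub>A\<^esub> y \<in> I" if "x \<in> H" "y \<in> H" "x \<noteq> \<one>\<^bsub>A\<^esub>" for x y
  proof -
    obtain i :: nat where "x = z [^]\<^bsub>A\<^esub> i"
    proof -
      have "A.ord z \<noteq> 0"
        using A.generate_pow_card[OF zA] finH zH by (auto simp: H_def)
      then show ?thesis
        using \<open>x \<in> H\<close> A.generate_pow_nat[OF zA] that by (auto simp: H_def)
    qed
    then show ?thesis using \<delta>_pow that by blast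
  qed

  \<comment> \<open>Subtracting a fixed entry turns the exclusion of the diagonal into the exclusion
    of a zero entry.\<close>
  have bij_div: "bij_betw (\<lambda>y. y \<otimes>\<^bsub>A\<^esub> inv\<^bsub>A\<^esub> x) (H - {x}) (H - {\<one>\<^bsub>A\<^esub>})" if "x \<in> H" for x
    by (rule bij_betw_byWitness[where f' = "\<lambda>y. y \<otimes>\<^bsub>A\<^esub> x"])
      (use that HA in \<open>auto simp: A.m_assoc A.inv_solve_right'\<close>)
  have bij_inv: "bij_betw (\<lambda>x. inv\<^bsub>A\<^esub> x) (H - {\<one>\<^bsub>A\<^esub>}) (H - {\<one>\<^bsub>A\<^esub>})"
    by (rule bij_betw_byWitness[where f' = "\<lambda>x. inv\<^bsub>A\<^esub> x"]) (use HA in \<open>auto simp: A.inv_eq_1_iff\<close>)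
  have const: "(\<Sum>x\<in>H - {\<one>\<^bsub>A\<^esub>}. c) = frag_cmul (N - 1) c" for c :: "'a multiset \<Rightarrow>\<^sub>0 int"
  proof -
    have "int (card (H - {\<one>\<^bsub>A\<^esub>})) = N - 1"
      using card.remove[OF finH H.one_closed] by (simp add: N_def)
    then show ?thesis by (simp only: sum_const_frag_cmul)
  qed
  have sum_split: "sum f H = f x + sum f (H - {x})" if "x \<in> H" for f :: "'a \<Rightarrow> ('a multiset \<Rightarrow>\<^sub>0 int)" and x
    using finH that by (rule sum.remove)

  have row: "frag_cmul 2 (\<Sum>x\<in>H. g x y) - frag_cmul (N + 1) (g \<one>\<^bsub>A\<^esub> y) \<in> I" if "y \<in> H" for y
  proof -
    have "(\<Sum>x\<in>H - {\<one>\<^bsub>A\<^esub>}. \<delta> x y - g \<one>\<^bsub>A\<^esub> y) \<in> I"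
      using \<delta>_eq that by (intro I_sum) auto
    also have "(\<Sum>x\<in>H - {\<one>\<^bsub>A\<^esub>}. \<delta> x y - g \<one>\<^bsub>A\<^esub> y)
        = (\<Sum>x\<in>H - {\<one>\<^bsub>A\<^esub>}. g x y) + (\<Sum>x\<in>H - {\<one>\<^bsub>A\<^esub>}. g (inv\<^bsub>A\<^esub> x) y) - frag_cmul (N - 1) (g \<one>\<^bsub>A\<^esub> y)"
      by (simp add: sum_subtractf sum.distrib \<delta>_def const del: sum_constant)
    also have "(\<Sum>x\<in>H - {\<one>\<^bsub>A\<^esub>}. g (inv\<^bsub>A\<^esub> x) y) = (\<Sum>x\<in>H - {\<one>\<^bsub>A\<^esub>}. g x y)"
      using sum.reindex_bij_betw[OF bij_inv, of "\<lambda>x. g x y"] .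
    \<comment> \<open>The \<open>N - 1\<close> nonzero \<open>x\<close> account for
      \<open>(N - 1) g(0, y)\<close>; completing both sums by their term at \<open>x = 0\<close>
      adds 2, whence \<open>N + 1\<close>.\<close>
    also have "(\<Sum>x\<in>H - {\<one>\<^bsub>A\<^esub>}. g x y) + (\<Sum>x\<in>H - {\<one>\<^bsub>A\<^esub>}. g x y) - frag_cmul (N - 1) (g \<one>\<^bsub>A\<^esub> y)
        = frag_cmul 2 (\<Sum>x\<in>H. g x y) - frag_cmul (N + 1) (g \<one>\<^bsub>A\<^esub> y)"
      unfolding sum_split[OF H.one_closed, of "\<lambda>x. g x y"]
      by (rule poly_mapping_eqI)
        (simp only: lookup_add lookup_minus lookup_frag_cmul, simp add: algebra_simps)
    finally show ?thesis .
  qed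

  define T where "T = (\<Sum>x\<in>H. \<Sum>y\<in>H. g x y)"
  define D where "D = (\<Sum>x\<in>H. g x x)"
  define U where "U = (\<Sum>y\<in>H. g \<one>\<^bsub>A\<^esub> y)"
  \<comment> \<open>Over off-diagonal pairs, each of the two difference terms runs through all pairs
    except those with one prescribed entry zero, and so sums to \<open>T - U\<close>.\<close>
  have "(\<Sum>x\<in>H. \<Sum>y\<in>H - {x}. g x y - g x (y \<otimes>\<^bsub>A\<^esub> inv\<^bsub>A\<^esub> x) - g (x \<otimes>\<^bsub>A\<^esub> inv\<^bsub>A\<^esub> y) y) \<in> I"
    using g_rel by (intro I_sum) auto
  also have "(\<Sum>x\<in>H. \<Sum>y\<in>H - {x}. g x y - g x (y \<otimes>\<^bsub>A\<^esub> inv\<^bsub>A\<^esub> x) - g (x \<otimes>\<^bsub>A\<^esub> inv\<^bsub>A\<^esub> y) y)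
    = (\<Sum>x\<in>H. \<Sum>y\<in>H - {x}. g x y) - (\<Sum>x\<in>H. \<Sum>y\<in>H - {x}. g x (y \<otimes>\<^bsub>A\<^esub> inv\<^bsub>A\<^esub> x))
      - (\<Sum>x\<in>H. \<Sum>y\<in>H - {x}. g (x \<otimes>\<^bsub>A\<^esub> inv\<^bsub>A\<^esub> y) y)"
    by (simp add: sum_subtractf)
  also have "(\<Sum>x\<in>H. \<Sum>y\<in>H - {x}. g x y) = T - D"
    unfolding T_def D_def sum_subtractf[symmetric]
    by (intro sum.cong refl) (metis add_diff_cancel_left' sum_split)
  also have off1: "(\<Sum>x\<in>H. \<Sum>y\<in>H - {x}. g x (y \<otimes>\<^bsub>A\<^esub> inv\<^bsub>A\<^esub> x)) = T - U"
    unfolding T_def U_def sum_subtractf[symmetric]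
  proof (intro sum.cong refl)
    fix x assume x: "x \<in> H"
    show "(\<Sum>y\<in>H - {x}. g x (y \<otimes>\<^bsub>A\<^esub> inv\<^bsub>A\<^esub> x)) = (\<Sum>y\<in>H. g x y) - g \<one>\<^bsub>A\<^esub> x"
      using sum.reindex_bij_betw[OF bij_div[OF x], of "g x"]
      by (simp add: sum_split[OF H.one_closed] g_sym)
  qed
  also have "(\<Sum>x\<in>H. \<Sum>y\<in>H - {x}. g (x \<otimes>\<^bsub>A\<^esub> inv\<^bsub>A\<^esub> y) y) = T - U"
  proof -
    have "(\<Sum>x\<in>H. \<Sum>y\<in>H - {x}. g (x \<otimes>\<^bsub>A\<^esub> inv\<^bsub>A\<^esub> y) y) = (\<Sum>y\<in>H. \<Sum>x\<in>H - {y}. g y (x \<otimes>\<^bsub>A\<^esub> inv\<^bsub>A\<^esub> y))"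
      using finH by (subst sum.Sigma, simp, simp, subst sum.Sigma, simp, simp)
        (rule sum.reindex_bij_witness[where i = prod.swap and j = prod.swap], auto simp: g_sym)
    then show ?thesis using off1 by simp
  qed
  finally have count: "(T - D) - (T - U) - (T - U) \<in> I" .
  have diag: "D - U \<in> I"
    unfolding D_def U_def sum_subtractf[symmetric] using g_eq by (intro I_sum)
  have total: "T - U \<in> I"
  proof -
    \<comment> \<open>The summed relation plus \<open>D - U\<close> equals \<open>-(T - U)\<close>.
      Subtracting it from zero, written as \<open>(D - U) - (D - U)\<close>, flips the sign.\<close>
    have "(D - U) - (D - U) - (((T - D) - (T - U) - (T - U)) + (D - U)) \<in> I"
      by (intro I_diff I_add count diag)
    also have "(D - U) - (D - U) - (((T - D) - (T - U) - (T - U)) + (D - U)) = T - U"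
      by (rule poly_mapping_eqI) (simp only: lookup_add lookup_minus)
    finally show ?thesis .
  qed

  have "(\<Sum>y\<in>H. frag_cmul 2 (\<Sum>x\<in>H. g x y) - frag_cmul (N + 1) (g \<one>\<^bsub>A\<^esub> y)) \<in> I"
    using row by (intro I_sum)
  also have "(\<Sum>y\<in>H. frag_cmul 2 (\<Sum>x\<in>H. g x y) - frag_cmul (N + 1) (g \<one>\<^bsub>A\<^esub> y))
    = frag_cmul 2 T - frag_cmul (N + 1) U"
    unfolding T_def U_def sum_subtractf frag_cmul_sum[symmetric] by (subst sum.swap) simp
  finally have "frag_cmul 2 T - frag_cmul (N + 1) U \<in> I" .
  from I_diff[OF this I_cmul[OF total, of 2]]
  have "frag_cmul 2 T - frag_cmul (N + 1) U - frag_cmul 2 (T - U) \<in> I" .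
  also have "frag_cmul 2 T - frag_cmul (N + 1) U - frag_cmul 2 (T - U) = frag_cmul (1 - N) U"
    by (rule poly_mapping_eqI)
      (simp only: lookup_minus lookup_frag_cmul, simp add: algebra_simps)
  finally have "frag_cmul (1 - N) U \<in> I" .
  \<comment> \<open>In the row at the zero entry, symmetry of \<open>g\<close> makes the row sum
    equal to \<open>U\<close>; the coefficients chosen next eliminate \<open>U\<close>.\<close>
  moreover have "frag_cmul 2 U - frag_cmul (N + 1) (g \<one>\<^bsub>A\<^esub> \<one>\<^bsub>A\<^esub>) \<in> I"
    using row[OF H.one_closed] by (simp add: U_def g_sym)
  ultimately have "frag_cmul (- 2) (frag_cmul (1 - N) U)
      - frag_cmul (N - 1) (frag_cmul 2 U - frag_cmul (N + 1) (g \<one>\<^bsub>A\<^esub> \<one>\<^bsub>A\<^esub>)) \<in> I"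
    by (rule I_diff[OF I_cmul I_cmul])
  also have "frag_cmul (- 2) (frag_cmul (1 - N) U)
      - frag_cmul (N - 1) (frag_cmul 2 U - frag_cmul (N + 1) (g \<one>\<^bsub>A\<^esub> \<one>\<^bsub>A\<^esub>))
    = frag_cmul (N ^ 2 - 1) (g \<one>\<^bsub>A\<^esub> \<one>\<^bsub>A\<^esub>)"
    by (rule poly_mapping_eqI)
      (simp only: lookup_minus lookup_frag_cmul, simp add: power2_eq_square algebra_simps)
  finally show ?thesis unfolding I_def N_def H_def g_def .
qed

section \<open>Existence of a nontrivial character\<close>

text \<open>The list \<open>?p m\<close> is the polynomial 1 + X + ... + X^(m-1). It splits and has
  degree at least 1, so it has a root. Its value at 1 is \<open>m\<close>, nonzero by hypothesis, so
  the root is not 1; multiplying by X - 1 shows that it is an \<open>m\<close>-th root of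
  unity.\<close>

lemma (in algebraically_closed) nontrivial_root_of_unity:
  assumes "(m :: nat) \<ge> 2" "[m] \<cdot>\<^bsub>L\<^esub> \<one>\<^bsub>L\<^esub> \<noteq> \<zero>\<^bsub>L\<^esub>"
  obtains \<zeta> where "\<zeta> \<in> Units L" "\<zeta> \<noteq> \<one>\<^bsub>L\<^esub>" "\<zeta> [^]\<^bsub>L\<^esub> m = \<one>\<^bsub>L\<^esub>"
proof -
  let ?p = "\<lambda>m. replicate m \<one>\<^bsub>L\<^esub>"
  have eval_carrier: "eval (?p k) x \<in> carrier L" if "x \<in> carrier L" for k x
    by (rule eval_in_carrier) (use that in auto)
  have geometric: "(x \<ominus>\<^bsub>L\<^esub> \<one>\<^bsub>L\<^esub>) \<otimes>\<^bsub>L\<^esub> eval (?p k) x = x [^]\<^bsub>L\<^esub> k \<ominus>\<^bsub>L\<^esub> \<one>\<^bsub>L\<^esub>"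
    if x: "x \<in> carrier L" for k x
  proof (induction k)
    case 0
    then show ?case using x by (simp add: minus_eq r_neg)
  next
    case (Suc k)
    have "(x \<ominus>\<^bsub>L\<^esub> \<one>\<^bsub>L\<^esub>) \<otimes>\<^bsub>L\<^esub> eval (?p (Suc k)) x
      = (x \<ominus>\<^bsub>L\<^esub> \<one>\<^bsub>L\<^esub>) \<otimes>\<^bsub>L\<^esub> (x [^]\<^bsub>L\<^esub> k) \<oplus>\<^bsub>L\<^esub> (x \<ominus>\<^bsub>L\<^esub> \<one>\<^bsub>L\<^esub>) \<otimes>\<^bsub>L\<^esub> eval (?p k) x"
      using x eval_carrier[OF x, of k] by (simp add: r_distr)
    also have "\<dots> = (x \<ominus>\<^bsub>L\<^esub> \<one>\<^bsub>L\<^esub>) \<otimes>\<^bsub>L\<^esub> (x [^]\<^bsub>L\<^esub> k) \<oplus>\<^bsub>L\<^esub> (x [^]\<^bsub>L\<^esub> k \<ominus>\<^bsub>L\<^esub> \<one>\<^bsub>L\<^esub>)"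
      by (simp only: Suc.IH)
    also have "\<dots> = x \<otimes>\<^bsub>L\<^esub> (x [^]\<^bsub>L\<^esub> k) \<ominus>\<^bsub>L\<^esub> \<one>\<^bsub>L\<^esub>"
    proof -
      have "x [^]\<^bsub>L\<^esub> k \<in> carrier L" using x by simp
      then show ?thesis using x by algebra
    qed
    also have "x \<otimes>\<^bsub>L\<^esub> (x [^]\<^bsub>L\<^esub> k) = x [^]\<^bsub>L\<^esub> Suc k" using x by (simp add: m_comm)
    finally show ?case .
  qed
  have eval_one: "eval (?p k) \<one>\<^bsub>L\<^esub> = [k] \<cdot>\<^bsub>L\<^esub> \<one>\<^bsub>L\<^esub>" for k
    by (induction k) (simp_all add: a_comm)
  have p: "?p m \<in> carrier (poly_ring L)"
    using assms(1) unfolding univ_poly_carrier[symmetric] polynomial_def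
    by (cases m) auto
  have "size (roots (?p m)) = m - 1"
    using roots_over_carrier[OF p] by (simp add: splitted_def)
  then have "roots (?p m) \<noteq> {#}" using assms(1) by auto
  then obtain \<zeta> where "\<zeta> \<in># roots (?p m)" by blast
  then have \<zeta>: "\<zeta> \<in> carrier L" "eval (?p m) \<zeta> = \<zero>\<^bsub>L\<^esub>"
    using roots_mem_iff_is_root[OF p] by (auto simp: is_root_def)
  show ?thesis
  proof
    show "\<zeta> \<noteq> \<one>\<^bsub>L\<^esub>" using \<zeta>(2) eval_one assms(2) by auto
    have "\<zeta> [^]\<^bsub>L\<^esub> m \<ominus>\<^bsub>L\<^esub> \<one>\<^bsub>L\<^esub> = \<zero>\<^bsub>L\<^esub>"
      using geometric[OF \<zeta>(1), of m] \<zeta> by simp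
    then show one: "\<zeta> [^]\<^bsub>L\<^esub> m = \<one>\<^bsub>L\<^esub>" using \<zeta>(1) by simp
    show "\<zeta> \<in> Units L"
      using one \<zeta>(1) assms(1) by (intro field_Units[THEN equalityD2, THEN subsetD])
        (auto simp: nat_pow_zero)
  qed
qed

text \<open>Take \<open>M\<close> maximal among the proper subgroups: any \<open>g\<close> outside
  \<open>M\<close> then generates the group together with \<open>M\<close>. Finiteness also gives
  \<open>g\<close> finite order, so natural exponents suffice.\<close>

lemma (in comm_group) finite_comm_group_cyclic_quotient:
  assumes "finite (carrier G)" "carrier G \<noteq> {\<one>}"
  obtains M g where "subgroup M G" "g \<in> carrier G" "g \<notin> M"
    "\<And>x. x \<in> carrier G \<Longrightarrow> \<exists>h\<in>M. \<exists>i::nat. x = h \<otimes> g [^] i"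
proof -
  define F where "F = {M. subgroup M G \<and> M \<noteq> carrier G}"
  have "F \<subseteq> Pow (carrier G)" by (auto simp: F_def dest: subgroup.subset)
  then have "finite F" using assms(1) by (meson finite_Pow_iff finite_subset)
  moreover have "{\<one>} \<in> F" using assms(2) triv_subgroup by (auto simp: F_def)
  ultimately obtain M where M: "M \<in> F" and max: "\<And>M'. M' \<in> F \<Longrightarrow> M \<subseteq> M' \<Longrightarrow> M = M'"
    using finite_has_maximal[of F] by blast
  interpret M: subgroup M G using M by (simp add: F_def)
  obtain g where g: "g \<in> carrier G" "g \<notin> M"
    using M M.subset by (auto simp: F_def)
  define J where "J = M <#> generate G {g}"
  have gen: "subgroup (generate G {g}) G" by (rule generate_is_subgroup) (use g in simp)
  have J: "subgroup J G" unfolding J_def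
    by (rule mult_subgroups[OF M.subgroup_axioms gen])
  have "M \<subseteq> J"
  proof
    fix x assume "x \<in> M"
    then have "x \<otimes> \<one> \<in> J" unfolding J_def set_mult_def using generate.one[of G "{g}"] by blast
    then show "x \<in> J" using \<open>x \<in> M\<close> by simp
  qed
  moreover have "g \<in> J"
  proof -
    have "\<one> \<otimes> g \<in> J" unfolding J_def set_mult_def using generate.incl[of g "{g}" G] M.one_closed by blast
    then show ?thesis using g by simp
  qed
  ultimately have "J \<notin> F" using max g(2) by blast
  then have J_eq: "J = carrier G" using J by (simp add: F_def)
  have "ord g \<noteq> 0" using ord_ge_1[OF assms(1) g(1)] by simp
  then have gen_eq: "generate G {g} = {g [^] i | i. i \<in> (UNIV :: nat set)}"
    by (rule generate_pow_nat[OF g(1)])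
  show ?thesis
  proof
    show "\<exists>h\<in>M. \<exists>i::nat. x = h \<otimes> g [^] i" if "x \<in> carrier G" for x
      using that unfolding J_eq[symmetric] J_def set_mult_def gen_eq by blast
  qed (use g M.subgroup_axioms in auto)
qed

text \<open>A character of the nontrivial cyclic quotient by \<open>M\<close> is pulled back to
  \<open>G\<close>: it sends \<open>h g^i\<close> to the \<open>i\<close>-th power of a root of
  unity other than 1 whose order divides that of \<open>g\<close> modulo \<open>M\<close>.\<close>

lemma nontrivial_character_group:
  assumes "algebraically_closed K"
    and char: "\<And>m :: nat. m > 0 \<Longrightarrow> [m] \<cdot>\<^bsub>K\<^esub> \<one>\<^bsub>K\<^esub> \<noteq> \<zero>\<^bsub>K\<^esub>"
    and "comm_group G" "finite (carrier G)" "carrier G \<noteq> {\<one>\<^bsub>G\<^esub>}"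
  shows "carrier (character_group G K) \<noteq> {\<one>\<^bsub>character_group G K\<^esub>}"
proof -
  interpret K: algebraically_closed K by fact
  interpret G: comm_group G by fact
  obtain M g where M: "subgroup M G" and g: "g \<in> carrier G" "g \<notin> M"
    and dec: "\<And>x. x \<in> carrier G \<Longrightarrow> \<exists>h\<in>M. \<exists>i::nat. x = h \<otimes>\<^bsub>G\<^esub> g [^]\<^bsub>G\<^esub> i"
    using G.finite_comm_group_cyclic_quotient[OF assms(4,5)] by blast
  interpret M: subgroup M G by fact
  \<comment> \<open>The order of \<open>g\<close> modulo \<open>M\<close>. The order of
    \<open>G\<close> shows that such exponents exist, and \<open>g\<close> outside \<open>M\<close>
    forces \<open>k\<close> to be at least 2.\<close>
  define k where "k = (LEAST k :: nat. k > 0 \<and> g [^]\<^bsub>G\<^esub> k \<in> M)"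
  have "order G > 0 \<and> g [^]\<^bsub>G\<^esub> order G \<in> M"
    using G.pow_order_eq_1[OF g(1)] G.order_gt_0_iff_finite assms(4) by simp
  then have k: "k > 0" "g [^]\<^bsub>G\<^esub> k \<in> M"
    using LeastI[of "\<lambda>k. k > 0 \<and> g [^]\<^bsub>G\<^esub> k \<in> M" "order G"] by (simp_all add: k_def)
  have k_min: "r = 0" if "r < k" "g [^]\<^bsub>G\<^esub> r \<in> M" for r
    using that not_less_Least[of r "\<lambda>k. k > 0 \<and> g [^]\<^bsub>G\<^esub> k \<in> M"] by (auto simp: k_def)
  have "k \<noteq> 1" using k g by auto
  then have "k \<ge> 2" using k by simp
  obtain \<zeta> where \<zeta>: "\<zeta> \<in> Units K" "\<zeta> \<noteq> \<one>\<^bsub>K\<^esub>" "\<zeta> [^]\<^bsub>K\<^esub> k = \<one>\<^bsub>K\<^esub>"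
    using K.nontrivial_root_of_unity[OF \<open>k \<ge> 2\<close> char[OF k(1)]] .
  have \<zeta>K: "\<zeta> \<in> carrier K" using \<zeta>(1) by blast
  have g_dvd: "k dvd i" if "g [^]\<^bsub>G\<^esub> i \<in> M" for i
  proof -
    have "g [^]\<^bsub>G\<^esub> i = (g [^]\<^bsub>G\<^esub> k) [^]\<^bsub>G\<^esub> (i div k) \<otimes>\<^bsub>G\<^esub> g [^]\<^bsub>G\<^esub> (i mod k)"
      using g(1) by (simp add: G.nat_pow_pow G.nat_pow_mult)
    then have "g [^]\<^bsub>G\<^esub> (i mod k) = inv\<^bsub>G\<^esub> ((g [^]\<^bsub>G\<^esub> k) [^]\<^bsub>G\<^esub> (i div k)) \<otimes>\<^bsub>G\<^esub> g [^]\<^bsub>G\<^esub> i"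
      using g(1) by (simp add: G.inv_solve_left)
    moreover have "(g [^]\<^bsub>G\<^esub> k) [^]\<^bsub>G\<^esub> j \<in> M" for j :: nat
      by (induction j) (simp_all add: k)
    ultimately have "g [^]\<^bsub>G\<^esub> (i mod k) \<in> M" using that by simp
    then have "i mod k = 0" using k_min k(1) by simp
    then show ?thesis by auto
  qed
  \<comment> \<open>Well-definedness: equal products put the power of \<open>g\<close> with exponent
    \<open>j - i\<close> into \<open>M\<close>, so \<open>k\<close> divides \<open>j - i\<close>.
    Natural subtraction makes \<open>i \<le> j\<close> the basic case.\<close>
  have pow_eq_le: "\<zeta> [^]\<^bsub>K\<^esub> i = \<zeta> [^]\<^bsub>K\<^esub> j"
    if "h \<in> M" "h' \<in> M" "h \<otimes>\<^bsub>G\<^esub> g [^]\<^bsub>G\<^esub> i = h' \<otimes>\<^bsub>G\<^esub> g [^]\<^bsub>G\<^esub> j" "i \<le> j" for h h' and i j :: nat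
  proof -
    have hG: "h \<in> carrier G" "h' \<in> carrier G" using that M.subset by auto
    have "h \<otimes>\<^bsub>G\<^esub> g [^]\<^bsub>G\<^esub> i = h' \<otimes>\<^bsub>G\<^esub> g [^]\<^bsub>G\<^esub> (j - i) \<otimes>\<^bsub>G\<^esub> g [^]\<^bsub>G\<^esub> i"
      using that(3,4) hG g(1) by (simp add: G.m_assoc G.nat_pow_mult)
    then have "h = h' \<otimes>\<^bsub>G\<^esub> g [^]\<^bsub>G\<^esub> (j - i)" using hG g(1) by simp
    then have "g [^]\<^bsub>G\<^esub> (j - i) = inv\<^bsub>G\<^esub> h' \<otimes>\<^bsub>G\<^esub> h"
      using hG g(1) by (simp add: G.inv_solve_left)
    then have "k dvd j - i" using that(1,2) by (intro g_dvd) simp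
    then obtain q where "j - i = k * q" by blast
    then have "j = i + k * q" using that(4) by simp
    then have "\<zeta> [^]\<^bsub>K\<^esub> j = \<zeta> [^]\<^bsub>K\<^esub> i \<otimes>\<^bsub>K\<^esub> (\<zeta> [^]\<^bsub>K\<^esub> k) [^]\<^bsub>K\<^esub> q"
      using K.nat_pow_mult[OF \<zeta>K, of i "k * q"] K.nat_pow_pow[OF \<zeta>K, of k q] by metis
    then show ?thesis using \<zeta>K \<zeta>(3) by (simp add: K.nat_pow_one)
  qed
  have pow_eq: "\<zeta> [^]\<^bsub>K\<^esub> i = \<zeta> [^]\<^bsub>K\<^esub> j"
    if "h \<in> M" "h' \<in> M" "h \<otimes>\<^bsub>G\<^esub> g [^]\<^bsub>G\<^esub> i = h' \<otimes>\<^bsub>G\<^esub> g [^]\<^bsub>G\<^esub> j" for h h' and i j :: nat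
    using pow_eq_le[OF that] pow_eq_le[OF that(2,1) that(3)[symmetric]] nat_le_linear[of i j]
    by metis
  \<comment> \<open>An arbitrary choice of exponents; \<open>pow_eq\<close> makes the resulting
    character independent of it.\<close>
  obtain e :: "_ \<Rightarrow> nat" where e: "\<exists>h\<in>M. x = h \<otimes>\<^bsub>G\<^esub> g [^]\<^bsub>G\<^esub> e x" if "x \<in> carrier G" for x
    using dec by metis
  define \<chi> where "\<chi> = (\<lambda>x\<in>carrier G. \<zeta> [^]\<^bsub>K\<^esub> e x)"
  have \<chi>_eq: "\<chi> (h \<otimes>\<^bsub>G\<^esub> g [^]\<^bsub>G\<^esub> i) = \<zeta> [^]\<^bsub>K\<^esub> i" if "h \<in> M" for h and i :: nat
  proof -
    have x: "h \<otimes>\<^bsub>G\<^esub> g [^]\<^bsub>G\<^esub> i \<in> carrier G" using that M.subset g(1) by auto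
    with e[OF x] show ?thesis
      using pow_eq[OF _ that] by (auto simp: \<chi>_def)
  qed
  have "\<chi> \<in> hom G (units_of K)"
  proof (rule homI)
    show "\<chi> x \<in> carrier (units_of K)" if "x \<in> carrier G" for x
      using that \<zeta>(1) by (simp add: \<chi>_def units_of_carrier K.Units_pow_closed)
    show "\<chi> (x \<otimes>\<^bsub>G\<^esub> y) = \<chi> x \<otimes>\<^bsub>units_of K\<^esub> \<chi> y" if xy: "x \<in> carrier G" "y \<in> carrier G" for x y
    proof -
      obtain h h' i j where h: "h \<in> M" "h' \<in> M" "x = h \<otimes>\<^bsub>G\<^esub> g [^]\<^bsub>G\<^esub> (i::nat)" "y = h' \<otimes>\<^bsub>G\<^esub> g [^]\<^bsub>G\<^esub> (j::nat)"
        using dec[OF xy(1)] dec[OF xy(2)] by blast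
      have hG: "h \<in> carrier G" "h' \<in> carrier G" using h M.subset by auto
      have "x \<otimes>\<^bsub>G\<^esub> y = (h \<otimes>\<^bsub>G\<^esub> h') \<otimes>\<^bsub>G\<^esub> g [^]\<^bsub>G\<^esub> (i + j)"
        using hG g(1) by (simp add: h(3,4) G.nat_pow_mult[symmetric] G.m_ac)
      then have "\<chi> (x \<otimes>\<^bsub>G\<^esub> y) = \<zeta> [^]\<^bsub>K\<^esub> (i + j)" using \<chi>_eq h(1,2) by simp
      then show ?thesis
        using \<chi>_eq[OF h(1)] \<chi>_eq[OF h(2)] \<zeta>K by (simp add: h(3,4) units_of_mult K.nat_pow_mult)
    qed
  qed
  then have "\<chi> \<in> carrier (character_group G K)"
    by (simp add: character_group_def \<chi>_def)
  moreover have "\<chi> g \<noteq> \<one>\<^bsub>K\<^esub>"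
    using \<chi>_eq[OF M.one_closed, of 1] g(1) \<zeta>K \<zeta>(2) by simp
  then have "\<chi> \<noteq> \<one>\<^bsub>character_group G K\<^esub>"
    using g(1) by (auto simp: character_group_def)
  ultimately show ?thesis by blast
qed

section \<open>A common exponent and a uniform torsion bound\<close>

text \<open>Powers of a character are pointwise and can be moved into its argument, where Lagrange's
  theorem applies. This is how the finiteness of \<open>G\<close> bounds the orders of all
  characters.\<close>

lemma character_group_exponent:
  assumes "field K" "group G" "c \<in> carrier (character_group G K)"
  shows "c [^]\<^bsub>character_group G K\<^esub> order G = \<one>\<^bsub>character_group G K\<^esub>"
proof -
  interpret K: field K by fact
  interpret G: group G by fact
  interpret U: comm_group "units_of K" by (rule K.units_comm_group)
  have c: "c \<in> hom G (units_of K)" using assms(3) by (simp add: character_group_def)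
  interpret c: group_hom G "units_of K" c
    by unfold_locales (rule c)
  have "c [^]\<^bsub>character_group G K\<^esub> m = (\<lambda>x\<in>carrier G. c (x [^]\<^bsub>G\<^esub> m))" for m :: nat
  proof (induction m)
    case 0
    have "(\<lambda>x\<in>carrier G. c (x [^]\<^bsub>G\<^esub> (0 :: nat))) = (\<lambda>x\<in>carrier G. \<one>\<^bsub>K\<^esub>)"
      using c.hom_one by (intro restrict_ext) (simp add: units_of_one)
    then show ?case by (simp add: character_group_def)
  next
    case (Suc m)
    have "c [^]\<^bsub>character_group G K\<^esub> Suc m
      = (\<lambda>x\<in>carrier G. (\<lambda>x\<in>carrier G. c (x [^]\<^bsub>G\<^esub> m)) x \<otimes>\<^bsub>K\<^esub> c x)"
      unfolding nat_pow_Suc Suc.IH by (simp add: character_group_def)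
    also have "\<dots> = (\<lambda>x\<in>carrier G. c (x [^]\<^bsub>G\<^esub> Suc m))"
      using c.hom_mult by (intro restrict_ext) (simp add: units_of_mult)
    finally show ?case .
  qed
  then have "c [^]\<^bsub>character_group G K\<^esub> order G = (\<lambda>x\<in>carrier G. c (x [^]\<^bsub>G\<^esub> order G))" .
  also have "\<dots> = (\<lambda>x\<in>carrier G. \<one>\<^bsub>K\<^esub>)"
    using c.hom_one G.pow_order_eq_1 by (intro restrict_ext) (simp add: units_of_one)
  finally show ?thesis by (simp add: character_group_def)
qed

text \<open>A common multiple of the numbers \<open>N\<^sup>2 - 1\<close> of \<open>double_zero_torsion\<close> for all possible
  orders \<open>N\<close> of an element of a group of exponent \<open>e\<close>.\<close>

definition torsion_bound :: "nat \<Rightarrow> nat" where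
  "torsion_bound e = (\<Prod>N=2..e. N ^ 2 - 1)"

text \<open>Starting the product at 2 omits the vanishing factor at \<open>N = 1\<close>.\<close>

lemma torsion_bound_pos: "torsion_bound e > 0"
  unfolding torsion_bound_def
proof (rule prod_pos)
  fix N :: nat assume "N \<in> {2..e}"
  then have "2 ^ 2 \<le> N ^ 2" by (intro power_mono) auto
  then show "0 < N ^ 2 - 1" by simp
qed

text \<open>One multiple must work for all such symbols at once, since a single homomorphism on M_n
  is scaled by it. The order of a nontrivial entry divides \<open>e\<close>, so its factor occurs in
  the product.\<close>

lemma torsion_bound_double_zero:
  assumes "comm_group A" "carrier A \<noteq> {\<one>\<^bsub>A\<^esub>}"
    and e: "e > 0" "\<And>a. a \<in> carrier A \<Longrightarrow> a [^]\<^bsub>A\<^esub> (e :: nat) = \<one>\<^bsub>A\<^esub>"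
    and R: "B_relators n A \<subseteq> R" "R \<subseteq> carrier (free_Abelian_group (symbols n A))"
    and s: "s \<in> symbols n A" "count s \<one>\<^bsub>A\<^esub> \<ge> 2"
  shows "frag_cmul (int (torsion_bound e)) (frag_of s) \<in> relator_span (symbols n A) R"
proof -
  interpret A: comm_group A by fact
  \<comment> \<open>If all entries were trivial, the symbol would generate only the trivial
    subgroup, although it generates \<open>A\<close>.\<close>
  obtain z where z: "z \<in># s" "z \<noteq> \<one>\<^bsub>A\<^esub>"
  proof (rule ccontr)
    assume "\<not> thesis"
    then have "set_mset s \<subseteq> {\<one>\<^bsub>A\<^esub>}" using that by auto
    then have "generate A (set_mset s) \<subseteq> {\<one>\<^bsub>A\<^esub>}"
      using A.generate_one A.mono_generate by metis
    then show False using s(1) assms(2) A.one_closed by (auto simp: symbols_def)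
  qed
  have "{#\<one>\<^bsub>A\<^esub>, \<one>\<^bsub>A\<^esub>, z#} \<subseteq># s"
    using s(2) z by (auto simp: subseteq_mset_def not_less_eq_eq Suc_le_eq)
  then obtain b where b: "s = {#\<one>\<^bsub>A\<^esub>, \<one>\<^bsub>A\<^esub>, z#} + b"
    by (metis subset_mset.add_diff_inverse)
  have zA: "z \<in> carrier A" using s(1) z(1) by (rule symbols_carrier)
  define N where "N = A.ord z"
  have "N dvd e" using e(2)[OF zA] A.pow_eq_id[OF zA] by (simp add: N_def)
  then have "N \<noteq> 0" "N \<le> e" using e(1) by (auto dest: dvd_imp_le)
  moreover have "N \<noteq> 1" using A.ord_eq_1[OF zA] z(2) by (simp add: N_def)
  ultimately have "N ^ 2 - 1 dvd torsion_bound e"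
    unfolding torsion_bound_def by (intro dvd_prodI) auto
  then obtain q where q: "torsion_bound e = (N ^ 2 - 1) * q" by blast
  have N: "N = card (generate A {z})" using A.generate_pow_card[OF zA] by (simp add: N_def)
  have fin: "finite (generate A {z})" using N \<open>N \<noteq> 0\<close> by (metis card.infinite)
  \<comment> \<open>On the left the subtraction is truncated; \<open>N\<close> being nonzero makes
    both sides agree.\<close>
  have "int (N ^ 2 - 1) = int N ^ 2 - 1" using \<open>N \<noteq> 0\<close> by (simp add: of_nat_diff Suc_le_eq)
  then have "frag_cmul (int (torsion_bound e)) (frag_of s)
    = frag_cmul (int q) (frag_cmul (int (card (generate A {z})) ^ 2 - 1) (frag_of s))"
    by (simp add: q N mult.commute)
  also have "\<dots> \<in> relator_span (symbols n A) R"
    using span_cmul_int[OF R(2) double_zero_torsion[OF assms(1) R _ z(2) fin]] s(1)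
    unfolding b by blast
  finally show ?thesis .
qed

text \<open>The relation of M_n for two zero entries reads \<open>s = s + s\<close>.\<close>

lemma M_double_zero:
  assumes "group A" and R: "M_relators n A \<subseteq> R" "R \<subseteq> carrier (free_Abelian_group (symbols n A))"
    and s: "s \<in> symbols n A" "count s \<one>\<^bsub>A\<^esub> \<ge> 2"
  shows "frag_of s \<in> relator_span (symbols n A) R"
proof -
  interpret A: group A by fact
  have "{#\<one>\<^bsub>A\<^esub>, \<one>\<^bsub>A\<^esub>#} \<subseteq># s"
    using s(2) by (auto simp: subseteq_mset_def)
  then obtain b where b: "s = {#\<one>\<^bsub>A\<^esub>, \<one>\<^bsub>A\<^esub>#} + b"
    by (metis subset_mset.add_diff_inverse)
  have "subtract_relator A \<one>\<^bsub>A\<^esub> \<one>\<^bsub>A\<^esub> b \<in> relator_span (symbols n A) R"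
    by (rule generate.incl, rule subsetD[OF R(1)]) (use s(1) b in \<open>auto simp: M_relators_def\<close>)
  moreover have "subtract_relator A \<one>\<^bsub>A\<^esub> \<one>\<^bsub>A\<^esub> b = - frag_of s"
    by (simp add: subtract_relator_def b)
  ultimately show ?thesis using span_minus[OF R(2)] by fastforce
qed

section \<open>The scaled inverse of mu\<close>

text \<open>The weight is left arbitrary because sign relators and subtraction relators with unequal
  entries are merely scaled for every choice; equal entries alone constrain it.\<close>

definition weighted_symbol :: "('a, 'm) monoid_scheme \<Rightarrow> (nat \<Rightarrow> int) \<Rightarrow> 'a multiset \<Rightarrow> ('a multiset \<Rightarrow>\<^sub>0 int)" where
  "weighted_symbol A w s = frag_cmul (w (count s \<one>\<^bsub>A\<^esub>)) (frag_of s)"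

text \<open>Where an entry of the relation is zero, two of its terms cancel, so that only the weight
  of the zeros outside of the two entries matters.\<close>

lemma weighted_symbol_subtract:
  assumes "group A" "{#a1, a2#} + b \<in> symbols n A" "a1 \<noteq> a2"
  shows "frag_extend (weighted_symbol A w) (subtract_relator A a1 a2 b)
    = frag_cmul (w (count b \<one>\<^bsub>A\<^esub>)) (subtract_relator A a1 a2 b)"
proof -
  interpret A: group A by fact
  have a: "a1 \<in> carrier A" "a2 \<in> carrier A"
    using symbols_carrier[OF assms(2)] by auto
  have ne: "x \<otimes>\<^bsub>A\<^esub> inv\<^bsub>A\<^esub> y \<noteq> \<one>\<^bsub>A\<^esub>" if "x \<in> carrier A" "y \<in> carrier A" "x \<noteq> y" for x y
    using that A.inv_equality[of x "inv\<^bsub>A\<^esub> y"] by (metis A.inv_closed A.inv_inv)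
  show ?thesis
    using assms(3) a ne[of a1 a2] ne[of a2 a1]
    by (cases "a1 = \<one>\<^bsub>A\<^esub>"; cases "a2 = \<one>\<^bsub>A\<^esub>")
      (simp_all add: subtract_relator_def frag_extend_diff frag_extend_minus weighted_symbol_def
        frag_cmul_diff frag_cmul_uminus)
qed

text \<open>An inverse is trivial exactly when the element is, so both symbols of the relator carry
  the same weight.\<close>

lemma weighted_symbol_minus_relator:
  assumes "group A" "r \<in> minus_relators n A"
  obtains k where "frag_extend (weighted_symbol A w) r = frag_cmul k r"
proof -
  interpret A: group A by fact
  obtain a b where r: "r = frag_of ({#inv\<^bsub>A\<^esub> a#} + b) + frag_of ({#a#} + b)"
    and s: "{#a#} + b \<in> symbols n A"
    using assms(2) by (auto simp: minus_relators_def)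
  have "a \<in> carrier A" using symbols_carrier[OF s] by simp
  then have "count ({#inv\<^bsub>A\<^esub> a#} + b) \<one>\<^bsub>A\<^esub> = count ({#a#} + b) \<one>\<^bsub>A\<^esub>" by simp
  then have "frag_extend (weighted_symbol A w) r = frag_cmul (w (count ({#a#} + b) \<one>\<^bsub>A\<^esub>)) r"
    unfolding r frag_extend_add frag_extend_of weighted_symbol_def by (simp add: frag_cmul_distrib2)
  then show ?thesis by (rule that)
qed

text \<open>Twice the inverse of \<^const>\<open>mu_weight\<close>, where this is nonzero.\<close>

definition nu_weight :: "nat \<Rightarrow> int" where
  "nu_weight c = (if c = 0 then 2 else if c = 1 then 1 else 0)"

text \<open>The factor \<open>torsion_bound e\<close> clears denominators, so that the relators are
  respected before tensoring.\<close>

definition nu_symbol :: "('a, 'm) monoid_scheme \<Rightarrow> nat \<Rightarrow> 'a multiset \<Rightarrow> ('a multiset \<Rightarrow>\<^sub>0 int)" where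
  "nu_symbol A e = weighted_symbol A (\<lambda>c. int (torsion_bound e) * nu_weight c)"

lemma mu_nu_symbol_zero:
  assumes "count s \<one>\<^bsub>A\<^esub> \<ge> 2"
  shows "mu_symbol A s = 0" "nu_symbol A e s = 0"
  using assms by (auto simp: mu_symbol_def nu_symbol_def weighted_symbol_def nu_weight_def)

text \<open>For equal entries the relator is \<open>?s - 2 ?t\<close>, while B_n identifies
  \<open>?s\<close> with \<open>?t\<close>. Without zeros in \<open>b\<close> the weights 2 and 1
  turn it into a multiple of \<open>?s - ?t\<close>; with two or more zeros everything has weight 0.
  One zero is the case that consumes the torsion bound.\<close>

lemma nu_symbol_M_relators:
  assumes "comm_group A" "carrier A \<noteq> {\<one>\<^bsub>A\<^esub>}"
    and e: "e > 0" "\<And>a. a \<in> carrier A \<Longrightarrow> a [^]\<^bsub>A\<^esub> (e :: nat) = \<one>\<^bsub>A\<^esub>"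
    and R: "B_relators n A \<subseteq> R" "R \<subseteq> carrier (free_Abelian_group (symbols n A))"
    and r: "r \<in> M_relators n A"
  shows "frag_extend (nu_symbol A e) r \<in> relator_span (symbols n A) R"
proof -
  interpret A: comm_group A by fact
  have grp: "group A" by (rule A.group_axioms)
  obtain a1 a2 b where r: "r = subtract_relator A a1 a2 b" and s: "{#a1, a2#} + b \<in> symbols n A"
    using r by (auto simp: M_relators_def)
  have a: "a1 \<in> carrier A" using symbols_carrier[OF s] by auto
  define D where "D = int (torsion_bound e)"
  show ?thesis
  proof (cases "a1 = a2")
    case False
    then have "r \<in> relator_span (symbols n A) R"
      using R(1) r s unfolding B_relators_def by (intro generate.incl) blast
    then show ?thesis
      using span_cmul_int[OF R(2)] weighted_symbol_subtract[OF grp s False] r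
      by (simp add: nu_symbol_def)
  next
    case True
    let ?s = "frag_of ({#a1, a1#} + b)" and ?t = "frag_of ({#\<one>\<^bsub>A\<^esub>, a1#} + b)"
    have sa: "{#a1, a1#} + b \<in> symbols n A" using s True by simp
    have eq: "?s - ?t \<in> relator_span (symbols n A) R"
      using R(1) sa unfolding B_relators_def by (intro generate.incl) blast
    have r_eq: "r = ?s - ?t - ?t"
      using a True by (simp add: r subtract_relator_def add_mset_commute)
    have ext: "frag_extend (nu_symbol A e) r = nu_symbol A e ({#a1, a1#} + b)
        - nu_symbol A e ({#\<one>\<^bsub>A\<^esub>, a1#} + b) - nu_symbol A e ({#\<one>\<^bsub>A\<^esub>, a1#} + b)"
      by (simp only: r_eq frag_extend_diff frag_extend_of)
    consider "a1 = \<one>\<^bsub>A\<^esub> \<or> count b \<one>\<^bsub>A\<^esub> \<ge> 2" | "a1 \<noteq> \<one>\<^bsub>A\<^esub>" "count b \<one>\<^bsub>A\<^esub> = 0"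
      | "a1 \<noteq> \<one>\<^bsub>A\<^esub>" "count b \<one>\<^bsub>A\<^esub> = 1" by linarith
    then show ?thesis
    proof cases
      case 1
      then have "count ({#a1, a1#} + b) \<one>\<^bsub>A\<^esub> \<ge> 2" "count ({#\<one>\<^bsub>A\<^esub>, a1#} + b) \<one>\<^bsub>A\<^esub> \<ge> 2"
        by (auto simp flip: count_greater_zero_iff)
      then have "frag_extend (nu_symbol A e) r = 0"
        unfolding ext by (simp only: mu_nu_symbol_zero diff_self)
      then show ?thesis using span_zero[OF R(2)] by simp
    next
      case 2
      then have "frag_extend (nu_symbol A e) r = frag_cmul (D * 2) ?s - frag_cmul D ?t - frag_cmul D ?t"
        unfolding ext by (simp add: nu_symbol_def weighted_symbol_def nu_weight_def D_def)
      also have "\<dots> = frag_cmul (D * 2) (?s - ?t)"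
        by (rule poly_mapping_eqI) (simp only: lookup_minus lookup_frag_cmul, simp add: algebra_simps)
      finally show ?thesis using span_cmul_int[OF R(2) eq] by simp
    next
      case 3
      then have "frag_extend (nu_symbol A e) r = frag_cmul D ?s"
        unfolding ext by (simp add: nu_symbol_def weighted_symbol_def nu_weight_def D_def)
      \<comment> \<open>Trading \<open>?s\<close> for \<open>?t\<close> makes the second zero
        visible: \<open>?t\<close> has one from \<open>b\<close> and one from the relation.\<close>
      also have "\<dots> = frag_cmul D (?s - ?t) + frag_cmul D ?t"
        by (simp add: frag_cmul_diff)
      also have "\<dots> \<in> relator_span (symbols n A) R"
      proof (rule span_add[OF R(2) span_cmul_int[OF R(2) eq]])
        show "frag_cmul D ?t \<in> relator_span (symbols n A) R"
          unfolding D_def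
          by (rule torsion_bound_double_zero[OF assms(1,2) e R symbols_equal[OF grp sa]])
            (use 3 in simp_all)
      qed
      finally show ?thesis .
    qed
  qed
qed

lemma mu_nu_symbol_cmul:
  assumes "count s \<one>\<^bsub>A\<^esub> < 2"
  shows "frag_extend (nu_symbol A e) (mu_symbol A s) = frag_cmul (int (2 * torsion_bound e)) (frag_of s)"
    and "frag_extend (mu_symbol A) (nu_symbol A e s) = frag_cmul (int (2 * torsion_bound e)) (frag_of s)"
proof -
  have w: "int (mu_weight c) * nu_weight c = 2" if "c < 2" for c
    using that by (auto simp: mu_weight_def nu_weight_def)
  show "frag_extend (nu_symbol A e) (mu_symbol A s) = frag_cmul (int (2 * torsion_bound e)) (frag_of s)"
    "frag_extend (mu_symbol A) (nu_symbol A e s) = frag_cmul (int (2 * torsion_bound e)) (frag_of s)"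
    using w[OF assms]
    by (simp_all add: mu_symbol_eq nu_symbol_def weighted_symbol_def frag_extend_cmul mult_ac)
qed

section \<open>The rational isomorphisms\<close>

text \<open>The parameter \<open>Q\<close> treats mu and its minus version together: sign relators
  are added to both sides, and both maps only scale them.\<close>

lemma tensor_rat_mu_iso:
  assumes "comm_group A" "carrier A \<noteq> {\<one>\<^bsub>A\<^esub>}"
    and e: "e > 0" "\<And>a. a \<in> carrier A \<Longrightarrow> a [^]\<^bsub>A\<^esub> (e :: nat) = \<one>\<^bsub>A\<^esub>"
    and Q: "Q = {} \<or> Q = minus_relators n A"
  shows "tensor_rat_map (presented_group (symbols n A) (M_relators n A \<union> Q))
      (presented_map (symbols n A) (M_relators n A \<union> Q) (mu_symbol A))
    \<in> iso (tensor_rat (presented_group (symbols n A) (B_relators n A \<union> Q)))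
        (tensor_rat (presented_group (symbols n A) (M_relators n A \<union> Q)))"
proof -
  interpret A: comm_group A by fact
  have grp: "group A" by (rule A.group_axioms)
  let ?S = "symbols n A" and ?B = "B_relators n A \<union> Q" and ?M = "M_relators n A \<union> Q"
  let ?m = "2 * torsion_bound e"
  have Q_closed: "Q \<subseteq> carrier (free_Abelian_group ?S)"
    using Q by (elim disjE) (simp_all only: empty_subsetI minus_relators_closed[OF grp])
  have closed: "?B \<subseteq> carrier (free_Abelian_group ?S)" "?M \<subseteq> carrier (free_Abelian_group ?S)"
    using Un_least[OF B_relators_closed[OF grp] Q_closed]
      Un_least[OF M_relators_closed[OF grp] Q_closed] .
  show ?thesis
  proof (rule tensor_rat_presented_map_iso[where h' = "nu_symbol A e" and m = ?m, OF closed])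
    show "mu_symbol A s \<in> carrier (free_Abelian_group ?S)" if "s \<in> ?S" for s
      using that by (rule mu_symbol_closed)
    show "nu_symbol A e s \<in> carrier (free_Abelian_group ?S)" if "s \<in> ?S" for s
      using that keys_cmul[of _ "frag_of s"] by (auto simp: nu_symbol_def weighted_symbol_def)
    show "frag_extend (mu_symbol A) r \<in> relator_span ?S ?M" if "r \<in> ?B" for r
    proof (cases "r \<in> B_relators n A")
      case True
      have "relator_span ?S (M_relators n A) \<subseteq> relator_span ?S ?M"
        by (rule group.mono_generate[OF group_free_Abelian_group Un_upper1])
      then show ?thesis using mu_symbol_B_relators[OF grp True] by (rule subsetD)
    next
      case False
      with that Q have "Q = minus_relators n A" "r \<in> minus_relators n A" by auto
      then show ?thesis using mu_symbol_minus_relators[OF grp] by simp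
    qed
    show "frag_extend (nu_symbol A e) r \<in> relator_span ?S ?B" if r: "r \<in> ?M" for r
    proof (cases "r \<in> M_relators n A")
      case True
      show ?thesis
        by (rule nu_symbol_M_relators[OF assms(1,2) e Un_upper1 closed(1) True])
    next
      case False
      then have rQ: "r \<in> Q" and "r \<in> minus_relators n A" using r Q by auto
      obtain k where "frag_extend (nu_symbol A e) r = frag_cmul k r"
        unfolding nu_symbol_def
        by (rule weighted_symbol_minus_relator[OF grp \<open>r \<in> minus_relators n A\<close>])
      moreover have "r \<in> relator_span ?S ?B" using rQ by (intro generate.incl) simp
      ultimately show ?thesis using span_cmul_int[OF closed(1)] by simp
    qed
    show "?m > 0" using torsion_bound_pos by simp
    fix s assume s: "s \<in> ?S"
    show "frag_extend (nu_symbol A e) (mu_symbol A s) - frag_cmul (int ?m) (frag_of s) \<in> relator_span ?S ?B"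
    proof (cases "count s \<one>\<^bsub>A\<^esub> < 2")
      case True
      then show ?thesis using span_zero[OF closed(1)] by (simp only: mu_nu_symbol_cmul diff_self)
    next
      case False
      \<comment> \<open>Both maps vanish on such a symbol, so the difference is \<open>- ?m\<close>
        times it. In B_n this is minus twice the torsion relation; in M_n, below, the symbol itself
        is already zero.\<close>
      then have "count s \<one>\<^bsub>A\<^esub> \<ge> 2" by simp
      then have "frag_cmul (int (torsion_bound e)) (frag_of s) \<in> relator_span ?S ?B"
        by (rule torsion_bound_double_zero[OF assms(1,2) e(1) _ Un_upper1 closed(1) s, rotated]) (rule e(2))
      from span_cmul_int[OF closed(1) this, of "- 2"]
      show ?thesis using False by (simp add: mu_nu_symbol_zero)
    qed
    show "frag_extend (mu_symbol A) (nu_symbol A e s) - frag_cmul (int ?m) (frag_of s) \<in> relator_span ?S ?M"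
    proof (cases "count s \<one>\<^bsub>A\<^esub> < 2")
      case True
      then show ?thesis using span_zero[OF closed(2)] by (simp only: mu_nu_symbol_cmul diff_self)
    next
      case False
      then have "frag_cmul (- int ?m) (frag_of s) \<in> relator_span ?S ?M"
        by (intro span_cmul_int[OF closed(2)] M_double_zero[OF grp Un_upper1 closed(2) s]) simp
      then show ?thesis using False by (simp add: mu_nu_symbol_zero)
    qed
  qed
qed

theorem theorem1p2:
  fixes K :: "('k, 'r) ring_scheme"
    and G :: "('g, 'm) monoid_scheme"
    and n :: nat
  assumes "algebraically_closed K"
    and "\<And>m :: nat. m > 0 \<Longrightarrow> [m] \<cdot>\<^bsub>K\<^esub> \<one>\<^bsub>K\<^esub> \<noteq> \<zero>\<^bsub>K\<^esub>"
    and "comm_group G"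
    and "finite (carrier G)"
    and "carrier G \<noteq> {\<one>\<^bsub>G\<^esub>}"
    and "n \<ge> 2"
  shows "tensor_rat_map (M_group n G K) (mu n G K)
           \<in> iso (tensor_rat (B_group n G K)) (tensor_rat (M_group n G K)) \<and>
         tensor_rat_map (M_minus_group n G K) (mu_minus n G K)
           \<in> iso (tensor_rat (B_minus_group n G K)) (tensor_rat (M_minus_group n G K))"
proof -
  interpret K: algebraically_closed K by fact
  interpret G: comm_group G by fact
  have "comm_group (character_group G K)"
    by (rule comm_group_character_group[OF K.field_axioms G.group_axioms])
  moreover have "carrier (character_group G K) \<noteq> {\<one>\<^bsub>character_group G K\<^esub>}"
    using nontrivial_character_group[OF assms(1-5)] .
  \<comment> \<open>The order of \<open>G\<close> becomes the exponent \<open>e\<close>.\<close>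
  moreover have "order G > 0" using G.order_gt_0_iff_finite assms(4) by simp
  moreover note character_group_exponent[OF K.field_axioms G.group_axioms]
  ultimately have "tensor_rat_map
      (presented_group (symbols n (character_group G K)) (M_relators n (character_group G K) \<union> Q))
      (presented_map (symbols n (character_group G K)) (M_relators n (character_group G K) \<union> Q)
        (mu_symbol (character_group G K)))
    \<in> iso (tensor_rat (presented_group (symbols n (character_group G K)) (B_relators n (character_group G K) \<union> Q)))
        (tensor_rat (presented_group (symbols n (character_group G K)) (M_relators n (character_group G K) \<union> Q)))"
    if "Q = {} \<or> Q = minus_relators n (character_group G K)" for Q
    using that by (rule tensor_rat_mu_iso)
  from this[of "{}"] this[of "minus_relators n (character_group G K)"] show ?thesis
    by (simp add: mu_def mu_minus_def B_group_def M_group_def B_minus_group_def M_minus_group_def)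
qed

end
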